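(* Let $(R,\mathfrak m)$ be a Noetherian local ring with infinite residue field. Let $\{I_n\}_{n\ge1}$ be a filtration of proper ideals of $R$ (i.e. $I_{n+1}\subseteq I_n$ and $I_aI_b\subseteq I_{a+b}$ for all $a,b\ge1$) such that $\dim R/I_n=\dim R/I_1$ for all $n\ge1$. Then: (i) $r(R/I_n)\le [r(R/I_1)+1]n-1$ for all $n\ge1$; (ii) the limit $c=\lim_{n\to\infty} r(R/I_n)/n$ exists and $r(R/I_n)\ge cn-1$ for all $n\ge1$.
   Context: For a Noetherian local ring $(A,\mathfrak n)$ with infinite residue field: an $\mathfrak n$-primary ideal $\mathfrak q\subseteq\mathfrak n$ is a reduction of $\mathfrak n$ if $\mathfrak n^{r+1}=\mathfrak q\mathfrak n^r$ for some $r\ge0$; the least such $r$ is the reduction number $r_{\mathfrak q}(A)$. A reduction is minimal if it contains no other reduction of $\mathfrak n$. Set $r(A)=\min\{r_{\mathfrak q}(A):\ \mathfrak q \text{ a minimal reduction of }\mathfrak n\}$. *)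

theory Defs
  imports "HOL-Analysis.Analysis" "HOL-Algebra.Ideal_Product" "HOL-Algebra.QuotRing"
    "HOL-Algebra.Ring_Divisibility"
begin

fun ideal_pow :: "('a, 'b) ring_scheme \<Rightarrow> 'a set \<Rightarrow> nat \<Rightarrow> 'a set" where
  "ideal_pow A I 0 = carrier A"
| "ideal_pow A I (Suc k) = ideal_prod A I (ideal_pow A I k)"

definition noeth_local :: "('a, 'b) ring_scheme \<Rightarrow> 'a set \<Rightarrow> bool" where
  "noeth_local A m \<longleftrightarrow> cring A \<and> noetherian_ring A \<and> maximalideal m A \<and>
     (\<forall>J. maximalideal J A \<longrightarrow> J = m)"

definition max_ideal :: "('a, 'b) ring_scheme \<Rightarrow> 'a set" where
  "max_ideal A = (THE m. maximalideal m A)"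

definition krull_dim :: "('a, 'b) ring_scheme \<Rightarrow> enat" where
  "krull_dim A = Sup {enat k | k. \<exists>P :: nat \<Rightarrow> 'a set.
       (\<forall>i\<le>k. primeideal (P i) A) \<and> (\<forall>i<k. P i \<subset> P (Suc i))}"

definition radical :: "('a, 'b) ring_scheme \<Rightarrow> 'a set \<Rightarrow> 'a set" where
  "radical A I = {x \<in> carrier A. \<exists>k::nat. x [^]\<^bsub>A\<^esub> k \<in> I}"

definition primary_to :: "('a, 'b) ring_scheme \<Rightarrow> 'a set \<Rightarrow> 'a set \<Rightarrow> bool" where
  "primary_to A n q \<longleftrightarrow> ideal q A \<and> q \<noteq> carrier A \<and>
     (\<forall>a\<in>carrier A. \<forall>b\<in>carrier A. a \<otimes>\<^bsub>A\<^esub> b \<in> q \<longrightarrow> a \<notin> q \<longrightarrow> b \<in> radical A q) \<and>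
     radical A q = n"

definition is_reduction :: "('a, 'b) ring_scheme \<Rightarrow> 'a set \<Rightarrow> 'a set \<Rightarrow> bool" where
  "is_reduction A n q \<longleftrightarrow> primary_to A n q \<and> q \<subseteq> n \<and>
     (\<exists>r. ideal_pow A n (Suc r) = ideal_prod A q (ideal_pow A n r))"

definition red_num_wrt :: "('a, 'b) ring_scheme \<Rightarrow> 'a set \<Rightarrow> 'a set \<Rightarrow> nat" where
  "red_num_wrt A n q = (LEAST r. ideal_pow A n (Suc r) = ideal_prod A q (ideal_pow A n r))"

definition minimal_reduction :: "('a, 'b) ring_scheme \<Rightarrow> 'a set \<Rightarrow> 'a set \<Rightarrow> bool" where
  "minimal_reduction A n q \<longleftrightarrow> is_reduction A n q \<and>
     (\<forall>q'. is_reduction A n q' \<and> q' \<subseteq> q \<longrightarrow> q' = q)"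

definition red_num :: "('a, 'b) ring_scheme \<Rightarrow> nat" where
  "red_num A = Inf {red_num_wrt A (max_ideal A) q | q. minimal_reduction A (max_ideal A) q}"

end

theory Submission
  imports Defs
begin

text \<open>An ideal \<open>Q\<close> with \<open>m^(r+1) \<subseteq> Q m^r + I\<close> and \<open>m^(s+1) \<subseteq> Q m^s + J\<close> satisfies
  \<open>m^(r+s+2) \<subseteq> Q m^(r+s+1) + I J\<close>. So everything follows from subadditivity of
  \<open>n \<mapsto> r(R/I\<^sub>n) + 1\<close> and Fekete's lemma, once a single \<open>Q\<close> computes both \<open>r(R/I\<^sub>a)\<close> and
  \<open>r(R/I\<^sub>b)\<close> and induces a minimal reduction of \<open>R/I\<^sub>a\<^sub>+\<^sub>b\<close>. Minimal reductions are exactly the reductions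
  with the least possible number \<open>l\<close> of generators, and \<open>l\<close> is the same for all \<open>I\<^sub>n\<close> because
  \<open>I\<^sub>1\<close> is nilpotent modulo \<open>I\<^sub>n\<close>; given optimal generators \<open>x\<^sub>i\<close> for \<open>I\<^sub>a\<close> and \<open>y\<^sub>i\<close> for \<open>I\<^sub>b\<close>,
  the elements \<open>x\<^sub>i - t y\<^sub>i\<close> are optimal for both for all but finitely many residues of \<open>t\<close>.\<close>

text \<open>The obstacle is the claim about \<open>l\<close> generators, which is proved here
  without dimension theory. That every reduction contains one with at most \<open>l\<close>
  generators is an exchange argument: if \<open>J + (x)\<close> is a reduction modulo
  \<open>I\<close>, the components of the fibre cone modulo \<open>J\<close> have bounded dimension,
  so high monomials in two further elements \<open>y\<close>, \<open>z\<close> are dependent and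
  both can be merged into one \<open>y - t z\<close>. That a reduction with \<open>l\<close>
  generators is minimal is linear algebra over the residue field combined with Nakayama.

  Genericity in \<open>t\<close> is needed twice, for merging and for the pencil of the overview. A
  single counting lemma, \<open>geometric_mod_pencil_finite\<close>, does the work of determinants
  in both places: it is fed with the monomials \<open>y^i z^(n-i)\<close> in the first and with
  iterates of a map exchanging \<open>x_i\<close> for \<open>y_i\<close> in the second.

  Exponents must be preserved exactly where two quotients are compared, since one \<open>Q\<close>
  has to compute both reduction numbers. In the exchange argument they may grow, since only the
  existence of an exponent matters there.\<close>

no_notation Sum_Type.Plus (infixr \<open><+>\<close> 65)

section \<open>Ideal arithmetic\<close>

context cring
begin

text \<open>The colon ideal of \<open>C\<close> into \<open>K\<close> contains \<open>S\<close>,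
  hence all of \<open>Idl S\<close>. Products with an ideal given by generators are later checked on
  the generators in this way.\<close>

lemma Idl_prod_subsetI:
  assumes "S \<subseteq> carrier R" "ideal C R" "ideal K R"
    and "\<And>s c. s \<in> S \<Longrightarrow> c \<in> C \<Longrightarrow> s \<otimes> c \<in> K"
  shows "(Idl S) \<cdot> C \<subseteq> K"
proof -
  interpret C: ideal C R by fact
  interpret K: ideal K R by fact
  let ?A = "{x \<in> carrier R. \<forall>c\<in>C. x \<otimes> c \<in> K}"
  have "ideal ?A R"
  proof (rule idealI[OF ring_axioms])
    show "subgroup ?A (add_monoid R)"
      by (rule subgroup.intro)
        (auto simp: l_distr l_minus C.Icarr K.a_closed simp flip: a_inv_def)
  qed (auto simp: C.Icarr m_assoc K.I_l_closed C.I_l_closed)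
  moreover have "S \<subseteq> ?A" using assms by auto
  ultimately have "Idl S \<subseteq> ?A" by (rule genideal_minimal)
  show ?thesis
  proof
    fix z assume "z \<in> (Idl S) \<cdot> C"
    then show "z \<in> K"
      by induct (use \<open>Idl S \<subseteq> ?A\<close> in \<open>auto simp: K.a_closed\<close>)
  qed
qed

lemma ideal_prod_subsetI:
  assumes "ideal K R" "\<And>a b. a \<in> A \<Longrightarrow> b \<in> B \<Longrightarrow> a \<otimes> b \<in> K"
  shows "A \<cdot> B \<subseteq> K"
proof
  interpret K: ideal K R by fact
  fix z assume "z \<in> A \<cdot> B"
  then show "z \<in> K" by induct (auto simp: assms K.a_closed)
qed

lemma ideal_prod_mono:
  assumes "ideal A' R" "ideal B' R" "A \<subseteq> A'" "B \<subseteq> B'"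
  shows "A \<cdot> B \<subseteq> A' \<cdot> B'"
  using assms by (intro ideal_prod_subsetI ideal_prod_is_ideal) (auto intro: ideal_prod.prod)

lemma set_addE:
  assumes "z \<in> A <+> B"
  obtains a b where "a \<in> A" "b \<in> B" "z = a \<oplus> b"
  using assms by (auto simp: set_add_def')

lemma set_addI: "a \<in> A \<Longrightarrow> b \<in> B \<Longrightarrow> a \<oplus> b \<in> A <+> B"
  by (auto simp: set_add_def')

lemma set_add_assoc:
  assumes "A \<subseteq> carrier R" "B \<subseteq> carrier R" "C \<subseteq> carrier R"
  shows "A <+> B <+> C = A <+> (B <+> C)"
  using assms unfolding set_add_defs(1) by (simp add: add.set_mult_assoc)

lemma set_add_subsetI:
  assumes "ideal K R" "A \<subseteq> K" "B \<subseteq> K"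
  shows "A <+> B \<subseteq> K"
proof -
  interpret K: ideal K R by fact
  show ?thesis using assms by (auto simp: set_add_def' K.a_closed subsetD)
qed

lemma set_add_upper:
  assumes "ideal A R" "ideal B R"
  shows "A \<subseteq> A <+> B" "B \<subseteq> A <+> B"
proof -
  have *: "A \<union> B \<subseteq> carrier R"
    using assms by (auto intro: ideal.Icarr)
  show "A \<subseteq> A <+> B" "B \<subseteq> A <+> B"
    using genideal_self[OF *] union_genideal[OF assms] by auto
qed

lemma set_add_prod_subsetI:
  assumes "ideal A R" "ideal B R" "ideal C R" "ideal K R" "A \<cdot> C \<subseteq> K" "B \<cdot> C \<subseteq> K"
  shows "(A <+> B) \<cdot> C \<subseteq> K"
  unfolding ideal_prod_distr(2)[OF assms(3,1,2)] by (rule set_add_subsetI) fact+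

lemma set_add_mono:
  assumes "ideal A' R" "ideal B' R" "A \<subseteq> A'" "B \<subseteq> B'"
  shows "A <+> B \<subseteq> A' <+> B'"
  using assms by (auto simp: set_add_def')

lemma Idl_insert:
  assumes "a \<in> carrier R" "S \<subseteq> carrier R"
  shows "Idl (insert a S) = Idl {a} <+> Idl S"
proof
  have i: "ideal (Idl {a}) R" "ideal (Idl S) R" "ideal (Idl (insert a S)) R"
    using assms by (auto intro!: genideal_ideal)
  show "Idl (insert a S) \<subseteq> Idl {a} <+> Idl S"
    using i assms set_add_upper[OF i(1,2)] genideal_self[of "{a}"] genideal_self[of S]
    by (intro genideal_minimal add_ideals) auto
  show "Idl {a} <+> Idl S \<subseteq> Idl (insert a S)"
    using i assms by (intro set_add_subsetI subset_Idl_subset) auto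
qed

lemma Idl_empty: "Idl {} = {\<zero>}"
proof
  show "Idl {} \<subseteq> {\<zero>}" by (rule genideal_minimal[OF zeroideal]) simp
  have "ideal (Idl {}) R" by (rule genideal_ideal) simp
  then show "{\<zero>} \<subseteq> Idl {}"
    by (simp add: additive_subgroup.zero_closed ideal.axioms(1))
qed

lemma Idl_singleton_memE:
  assumes "x \<in> Idl {a}" "a \<in> carrier R"
  obtains b where "b \<in> carrier R" "x = b \<otimes> a"
  using assms cgenideal_eq_genideal[of a] by (auto simp: cgenideal_def)

lemma ideal_pow_ideal: "ideal I R \<Longrightarrow> ideal (ideal_pow R I k) R"
  by (induct k) (auto simp: oneideal ideal_prod_is_ideal)

lemma ideal_pow_add:
  assumes "ideal I R"
  shows "ideal_pow R I (j + k) = ideal_pow R I j \<cdot> ideal_pow R I k"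
proof (induct j)
  case 0
  then show ?case
    using ideal_prod_one[of "ideal_pow R I k"] ideal_pow_ideal[OF assms, of k]
      ideal_prod_commute[OF oneideal] by simp
qed (use assms in \<open>simp add: ideal_prod_assoc ideal_pow_ideal\<close>)

lemma ideal_pow_mult_closed:
  assumes "ideal I R" "a \<in> ideal_pow R I j" "b \<in> ideal_pow R I k"
  shows "a \<otimes> b \<in> ideal_pow R I (j + k)"
  unfolding ideal_pow_add[OF assms(1)] using assms by (intro ideal_prod.prod)

lemma nat_pow_mem_ideal_pow:
  assumes "ideal I R" "a \<in> I"
  shows "a [^] (k::nat) \<in> ideal_pow R I k"
proof (induct k)
  case (Suc k)
  have "a \<otimes> a [^] k \<in> ideal_pow R I (Suc k)"
    using Suc assms by (auto intro: ideal_prod.prod)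
  then show ?case
    using assms ideal.Icarr[OF assms] by (simp add: m_comm)
qed simp

end

section \<open>Noetherian local rings\<close>

lemma (in noetherian_ring) exists_maximalideal:
  assumes "ideal J R" "J \<noteq> carrier R"
  obtains M where "maximalideal M R" "J \<subseteq> M"
proof -
  define S where "S = {K. ideal K R \<and> J \<subseteq> K \<and> K \<noteq> carrier R}"
  have "\<exists>M\<in>S. \<forall>K\<in>S. M \<subseteq> K \<longrightarrow> K = M"
  proof (rule subset_Zorn)
    fix C assume C: "subset.chain S C"
    show "\<exists>U\<in>S. \<forall>K\<in>C. K \<subseteq> U"
    proof (cases "C = {}")
      case True
      then show ?thesis using assms by (auto simp: S_def)
    next
      case False
      have "subset.chain {I. ideal I R} C"
        using C by (auto simp: pred_on.chain_def S_def)
      \<comment> \<open>In a Noetherian ring a nonempty chain contains its own union, so properness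
        of \<open>\<Union>C\<close> is immediate.\<close>
      from ideal_chain_is_trivial[OF False this] have "\<Union>C \<in> S"
        using C by (auto simp: pred_on.chain_def)
      then show ?thesis by blast
    qed
  qed
  then obtain M where M: "M \<in> S" "\<And>K. K \<in> S \<Longrightarrow> M \<subseteq> K \<Longrightarrow> K = M" by blast
  have "maximalideal M R"
  proof (rule maximalidealI)
    show "ideal M R" "carrier R \<noteq> M" using M(1) by (auto simp: S_def)
    show "K = M \<or> K = carrier R" if "ideal K R" "M \<subseteq> K" for K
      using M(2)[of K] M(1) that by (auto simp: S_def)
  qed
  with M(1) that show thesis by (auto simp: S_def)
qed

locale noetherian_local_ring = cring R + noetherian_ring R + m: maximalideal m R
  for R (structure) and m +
  assumes maximalideal_unique: "maximalideal J R \<Longrightarrow> J = m"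
begin

lemma m_ideal: "ideal m R" ..

lemma m_carrier: "a \<in> m \<Longrightarrow> a \<in> carrier R"
  by (rule m.Icarr)

lemma proper_ideal_subset_m:
  assumes "ideal J R" "J \<noteq> carrier R"
  shows "J \<subseteq> m"
  using exists_maximalideal[OF assms] maximalideal_unique by metis

lemma unit_of_not_in_m:
  assumes "a \<in> carrier R" "a \<notin> m"
  obtains b where "b \<in> carrier R" "b \<otimes> a = \<one>"
proof -
  have "PIdl a = carrier R"
    using proper_ideal_subset_m[OF cgenideal_ideal[OF assms(1)]] cgenideal_self[OF assms(1)] assms(2)
    by blast
  then have "\<one> \<in> PIdl a" by simp
  then show thesis using that by (auto simp: cgenideal_def)
qed

lemma unit_mult_cancel_ideal:
  assumes "ideal K R" "a \<in> carrier R" "a \<notin> m" "x \<in> carrier R" "a \<otimes> x \<in> K"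
  shows "x \<in> K"
proof -
  obtain b where b: "b \<in> carrier R" "b \<otimes> a = \<one>" using unit_of_not_in_m assms by blast
  have "b \<otimes> (a \<otimes> x) \<in> K" using assms b by (simp add: ideal.I_l_closed)
  then show ?thesis using assms b by (simp flip: m_assoc)
qed

lemma one_minus_not_in_m:
  assumes "a \<in> m"
  shows "\<one> \<ominus> a \<notin> m"
proof
  assume "\<one> \<ominus> a \<in> m"
  then have "(\<one> \<ominus> a) \<oplus> a \<in> m" using assms by (rule m.a_closed)
  moreover have "(\<one> \<ominus> a) \<oplus> a = \<one>" using assms m_carrier by algebra
  ultimately show False using m.one_imp_carrier m.I_notcarr by auto
qed

section \<open>Nakayama's lemma and dimension counts over the residue field\<close>

text \<open>One generator is eliminated at a time, in place of the determinant trick: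
  \<open>g = u \<oplus> a \<otimes> g\<close> with \<open>a\<close> in \<open>m\<close> can be
  solved for \<open>g\<close> because \<open>\<one> \<ominus> a\<close> is a unit, and substituting
  the solution leaves the same hypothesis for the remaining generators.\<close>

lemma nakayama_generators:
  assumes "finite G" "G \<subseteq> carrier R" "ideal K R" "G \<subseteq> K <+> m \<cdot> (Idl G)"
  shows "G \<subseteq> K"
  using assms
proof (induct G rule: finite_induct)
  case (insert g G)
  have g: "g \<in> carrier R" and G: "G \<subseteq> carrier R" using insert by auto
  have iG: "ideal (Idl G) R" "ideal (Idl {g}) R" using g G by (auto intro!: genideal_ideal)
  have i: "ideal (m \<cdot> (Idl G)) R" "ideal (m \<cdot> (Idl {g})) R" "ideal (K <+> m \<cdot> (Idl G)) R"
    using iG m_ideal insert by (auto intro!: ideal_prod_is_ideal add_ideals)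
  have mg: "\<exists>a\<in>m. z = a \<otimes> g" if "z \<in> m \<cdot> (Idl {g})" for z
    using that
  proof (induct rule: ideal_prod.induct)
    case (prod i j)
    then obtain b where "b \<in> carrier R" "j = b \<otimes> g" using Idl_singleton_memE g by metis
    with prod g show ?case by (intro bexI[of _ "i \<otimes> b"]) (auto simp: m_assoc m_carrier m.I_r_closed)
  next
    case (sum s1 s2)
    then obtain a b where "a \<in> m" "b \<in> m" "s1 = a \<otimes> g" "s2 = b \<otimes> g" by blast
    then show ?case by (intro bexI[of _ "a \<oplus> b"]) (auto simp: l_distr m_carrier g m.a_closed)
  qed
  have *: "K <+> m \<cdot> (Idl (insert g G)) \<subseteq> (K <+> m \<cdot> (Idl G)) <+> m \<cdot> (Idl {g})"
    unfolding Idl_insert[OF g G] ideal_prod_distr(1)[OF m_ideal iG(2,1)]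
    using set_add_upper[OF i(3,2)] set_add_upper[OF \<open>ideal K R\<close> i(1)] i \<open>ideal K R\<close>
    by (intro set_add_subsetI add_ideals) auto
  have gK: "g \<in> K <+> m \<cdot> (Idl G)"
  proof -
    have "g \<in> (K <+> m \<cdot> (Idl G)) <+> m \<cdot> (Idl {g})" using * insert by auto
    then obtain u z where uz: "u \<in> K <+> m \<cdot> (Idl G)" "z \<in> m \<cdot> (Idl {g})" "g = u \<oplus> z"
      by (rule set_addE)
    obtain a where a: "a \<in> m" "z = a \<otimes> g" using mg[OF uz(2)] by blast
    have "g = u \<oplus> a \<otimes> g" unfolding a(2)[symmetric] by (rule uz(3))
    with uz(1) a(1) have u: "u \<in> K <+> m \<cdot> (Idl G)" "a \<in> m" "g = u \<oplus> a \<otimes> g" .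
    have uc: "u \<in> carrier R" by (rule ideal.Icarr[OF i(3) u(1)])
    have "(\<one> \<ominus> a) \<otimes> g = g \<ominus> a \<otimes> g" using u(2) g m_carrier by algebra
    also have "\<dots> = (u \<oplus> a \<otimes> g) \<ominus> a \<otimes> g" using u(3) by simp
    also have "\<dots> = u" using u(2) uc g m_carrier by algebra
    finally show ?thesis
      using unit_mult_cancel_ideal[OF i(3) _ one_minus_not_in_m[OF u(2)] g] u(1,2) m_carrier by simp
  qed
  have "m \<cdot> (Idl {g}) \<subseteq> K <+> m \<cdot> (Idl G)"
    using mg gK i(3) by (auto intro: ideal.I_l_closed m_carrier)
  then have sub: "K <+> m \<cdot> (Idl (insert g G)) \<subseteq> K <+> m \<cdot> (Idl G)"
    using * set_add_subsetI[OF i(3) subset_refl] by blast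
  then have "G \<subseteq> K" using insert by auto
  then have "m \<cdot> (Idl G) \<subseteq> K"
    using ideal_prod_inter[OF m_ideal iG(1)] genideal_minimal[OF \<open>ideal K R\<close>] by blast
  then have "K <+> m \<cdot> (Idl G) \<subseteq> K" by (intro set_add_subsetI[OF \<open>ideal K R\<close>]) auto
  with \<open>G \<subseteq> K\<close> gK show ?case by auto
qed simp

lemma nakayama:
  assumes "ideal M R" "ideal K R" "M \<subseteq> K <+> m \<cdot> M"
  shows "M \<subseteq> K"
proof -
  obtain G where G: "G \<subseteq> carrier R" "finite G" "M = Idl G" using finetely_gen[OF assms(1)] by blast
  have "G \<subseteq> K" using nakayama_generators[OF G(2,1) assms(2)] genideal_self[OF G(1)] assms(3) G(3) by auto
  then show ?thesis using genideal_minimal[OF assms(2)] G by auto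
qed

text \<open>When \<open>m\<close> kills \<open>(Idl W <+> U) / U\<close> the next lemma is the statement that a proper subspace of
  a vector space spanned by \<open>W\<close> is spanned by fewer vectors.\<close>

lemma subspace_generators:
  assumes "finite W" "W \<subseteq> carrier R" "ideal U R" "m \<cdot> (Idl W) \<subseteq> U"
    and "ideal D R" "U \<subseteq> D" "D \<subseteq> Idl W <+> U"
  shows "\<exists>V. finite V \<and> V \<subseteq> carrier R \<and> D = Idl V <+> U \<and> card V \<le> card W
    \<and> (D \<noteq> Idl W <+> U \<longrightarrow> card V < card W)"
  using assms
proof (induct W arbitrary: D rule: finite_induct)
  case empty
  then have "Idl {} <+> U \<subseteq> U"
    by (intro set_add_subsetI) (auto simp: Idl_empty additive_subgroup.zero_closed ideal.axioms(1))
  with empty have "D = Idl {} <+> U" by auto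
  then show ?case by blast
next
  case (insert x W)
  have x: "x \<in> carrier R" and W: "W \<subseteq> carrier R" using insert by auto
  interpret U: ideal U R by fact
  interpret D: ideal D R by fact
  have iW: "ideal (Idl W) R" "ideal (Idl {x}) R" "ideal (Idl (insert x W)) R"
    using x W by (auto intro!: genideal_ideal)
  \<comment> \<open>\<open>U1\<close> plays the hyperplane spanned by \<open>W\<close>. The
    induction handles \<open>D \<inter> U1\<close>, and the coordinate at \<open>x\<close> matters
    only if \<open>D\<close> leaves \<open>U1\<close>.\<close>
  define U1 where "U1 = Idl W <+> U"
  have iU1: "ideal U1 R" unfolding U1_def by (intro add_ideals iW U.is_ideal)
  interpret U1: ideal U1 R by fact
  have UU1: "U \<subseteq> U1" "Idl W \<subseteq> U1" unfolding U1_def using set_add_upper[OF iW(1) U.is_ideal] by auto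
  have mx: "m \<cdot> (Idl W) \<subseteq> U" "\<And>a. a \<in> m \<Longrightarrow> a \<otimes> x \<in> U"
  proof -
    have "m \<cdot> (Idl W) \<subseteq> m \<cdot> (Idl (insert x W))"
      using insert.prems(1) by (intro ideal_prod_mono m_ideal iW subset_Idl_subset) auto
    then show "m \<cdot> (Idl W) \<subseteq> U" using insert by auto
    show "a \<otimes> x \<in> U" if "a \<in> m" for a
      using that insert.prems genideal_self[OF insert.prems(1)] by (auto intro: ideal_prod.prod)
  qed
  have dec: "\<exists>a u. a \<in> carrier R \<and> u \<in> U1 \<and> z = a \<otimes> x \<oplus> u" if "z \<in> Idl (insert x W) <+> U" for z
  proof -
    have "Idl (insert x W) <+> U = Idl {x} <+> U1"
      unfolding Idl_insert[OF x W] U1_def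
      by (rule set_add_assoc) (use iW U.a_subset in \<open>auto intro: ideal.Icarr\<close>)
    with that obtain y u where "y \<in> Idl {x}" "u \<in> U1" "z = y \<oplus> u" by (auto elim: set_addE)
    moreover then obtain a where "a \<in> carrier R" "y = a \<otimes> x" using Idl_singleton_memE[OF _ x] by blast
    ultimately show ?thesis by blast
  qed
  have "ideal (D \<inter> U1) R" using i_intersect[OF D.is_ideal iU1] .
  moreover have "U \<subseteq> D \<inter> U1" "D \<inter> U1 \<subseteq> Idl W <+> U" using insert.prems UU1 by (auto simp: U1_def)
  ultimately obtain V where
    V: "finite V" "V \<subseteq> carrier R" "D \<inter> U1 = Idl V <+> U" "card V \<le> card W"
    "D \<inter> U1 \<noteq> U1 \<Longrightarrow> card V < card W"
    using insert(3)[OF W U.is_ideal mx(1), of "D \<inter> U1"] unfolding U1_def by metis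
  have cW: "card (insert x W) = Suc (card W)" using insert by simp
  show ?case
  proof (cases "D \<subseteq> U1")
    case True
    then have "D \<inter> U1 = D" by auto
    then show ?thesis using V cW by (metis le_imp_less_Suc less_imp_le)
  next
    case False
    then obtain q where q: "q \<in> D" "q \<notin> U1" by blast
    obtain a u where au: "a \<in> carrier R" "u \<in> U1" "q = a \<otimes> x \<oplus> u"
      using dec q insert.prems by blast
    \<comment> \<open>As \<open>q\<close> lies outside \<open>U1\<close>, its coordinate
      \<open>a\<close> at \<open>x\<close> is a unit, so multiples of \<open>q\<close> clear that
      coordinate from every element of \<open>D\<close>.\<close>
    have "a \<notin> m" using mx(2)[of a] au UU1 q U1.a_closed by auto
    then obtain b where b: "b \<in> carrier R" "b \<otimes> a = \<one>" using unit_of_not_in_m au by blast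
    have uc: "u \<in> carrier R" using au by simp
    have qc: "q \<in> carrier R" using au x uc by simp
    have iV: "ideal (Idl V) R" "ideal (Idl {q}) R" "ideal (Idl (insert q V)) R"
      using V qc by (auto intro!: genideal_ideal)
    have DV: "D = Idl (insert q V) <+> U"
    proof
      have ii: "ideal (Idl (insert q V) <+> U) R" using iV U.is_ideal add_ideals by blast
      have "V \<subseteq> D" using V(3) set_add_upper[OF iV(1) U.is_ideal] genideal_self[OF V(2)] by blast
      then show "Idl (insert q V) <+> U \<subseteq> D"
        using q insert.prems by (intro set_add_subsetI genideal_minimal D.is_ideal) auto
      have le: "D \<inter> U1 \<subseteq> Idl (insert q V) <+> U"
        unfolding V(3) using V(2) qc by (intro set_add_mono iV U.is_ideal subset_Idl_subset) auto
      have qin: "q \<in> Idl (insert q V) <+> U"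
        using set_add_upper[OF iV(3) U.is_ideal] genideal_self[of "insert q V"] V(2) qc by auto
      show "D \<subseteq> Idl (insert q V) <+> U"
      proof
        fix z assume z: "z \<in> D"
        obtain c w where cw: "c \<in> carrier R" "w \<in> U1" "z = c \<otimes> x \<oplus> w"
          using dec z insert.prems by blast
        have wc: "w \<in> carrier R" using cw by simp
        have bx: "x = b \<otimes> (a \<otimes> x)" using b au x by (simp flip: m_assoc)
        have "z \<ominus> (c \<otimes> b) \<otimes> q = (c \<otimes> x \<ominus> c \<otimes> (b \<otimes> (a \<otimes> x))) \<oplus> (w \<ominus> (c \<otimes> b) \<otimes> u)"
          unfolding au(3) cw(3) using x b(1) au(1) cw(1) wc uc by algebra
        also have "\<dots> = w \<ominus> (c \<otimes> b) \<otimes> u"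
          unfolding bx[symmetric] using x b(1) au(1) cw(1) wc uc by algebra
        finally have e: "z \<ominus> (c \<otimes> b) \<otimes> q = w \<ominus> (c \<otimes> b) \<otimes> u" .
        have "z \<ominus> (c \<otimes> b) \<otimes> q \<in> D \<inter> U1"
        proof
          show "z \<ominus> (c \<otimes> b) \<otimes> q \<in> D" using z q b cw by (simp add: a_minus_def D.I_l_closed)
          show "z \<ominus> (c \<otimes> b) \<otimes> q \<in> U1" unfolding e using au b cw by (simp add: a_minus_def U1.I_l_closed)
        qed
        then have "(z \<ominus> (c \<otimes> b) \<otimes> q) \<oplus> (c \<otimes> b) \<otimes> q \<in> Idl (insert q V) <+> U"
          using le qin b cw ii by (intro additive_subgroup.a_closed[OF ideal.axioms(1)[OF ii]])
             (auto intro: ideal.I_l_closed[OF ii])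
        moreover have "(z \<ominus> (c \<otimes> b) \<otimes> q) \<oplus> (c \<otimes> b) \<otimes> q = z"
          using z qc b cw(1) D.Icarr by algebra
        ultimately show "z \<in> Idl (insert q V) <+> U" by simp
      qed
    qed
    have card: "card (insert q V) \<le> Suc (card V)" using V(1) by (simp add: card_insert_if)
    \<comment> \<open>If \<open>D\<close> contained all of \<open>U1\<close>, it would also contain
      \<open>x = b \<otimes> (q \<ominus> u)\<close> and be the whole space. A proper
      \<open>D\<close> therefore already loses a dimension inside \<open>U1\<close>.\<close>
    have less: "card V < card W" if "D \<noteq> Idl (insert x W) <+> U"
    proof (rule V(5), rule notI)
      assume "D \<inter> U1 = U1"
      then have "U1 \<subseteq> D" by auto
      moreover have "x = b \<otimes> (q \<ominus> u)"
      proof -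
        have "b \<otimes> (q \<ominus> u) = b \<otimes> (a \<otimes> x)" unfolding au(3) using x b(1) au(1) uc by algebra
        then show ?thesis using b au x by (simp flip: m_assoc)
      qed
      moreover have "q \<ominus> u \<in> D" using q au(2) \<open>U1 \<subseteq> D\<close> by (auto simp: a_minus_def)
      ultimately have "x \<in> D" using b(1) D.I_l_closed by metis
      moreover have "W \<subseteq> D" using \<open>U1 \<subseteq> D\<close> UU1 genideal_self[OF W] by blast
      ultimately have "Idl (insert x W) <+> U \<subseteq> D"
        using insert.prems by (intro set_add_subsetI genideal_minimal D.is_ideal) auto
      with that insert.prems show False by auto
    qed
    have "card (insert q V) \<le> card (insert x W)"
      using V(4) cW card by linarith
    moreover have "D \<noteq> Idl (insert x W) <+> U \<longrightarrow> card (insert q V) < card (insert x W)"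
      using less cW card by (intro impI) simp
    moreover have "finite (insert q V)" "insert q V \<subseteq> carrier R" using V qc by auto
    ultimately show ?thesis using DV by (intro exI[of _ "insert q V"] conjI)
  qed
qed

text \<open>Modulo \<open>L t\<close> the sequence \<open>u\<close> is the geometric progression \<open>t ^ i u\<^sub>0\<close>. From pairwise
  incongruent parameters \<open>s\<^sub>0, s\<^sub>1, \<dots>\<close> with \<open>u\<^sub>0 \<notin> L s\<^sub>j\<close>, Newton's products
  \<open>(X - s\<^sub>0) \<dots> (X - s\<^sub>j\<^sub>-\<^sub>1)\<close> evaluated on \<open>u\<close> lie in \<open>L s\<^sub>l\<close> exactly for \<open>l < j\<close>, which gives
  a strictly decreasing chain of subspaces of a space of dimension at most \<open>n\<close>.\<close>

lemma geometric_mod_pencil_finite: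
  fixes n :: nat
  assumes G: "finite G" "G \<subseteq> carrier R" "card G \<le> n" and U: "ideal U R" "m \<cdot> (Idl G) \<subseteq> U"
    and u: "\<And>i. i \<le> n \<Longrightarrow> u i \<in> Idl G <+> U"
    and T: "T \<subseteq> carrier R" "\<And>s t. s \<in> T \<Longrightarrow> t \<in> T \<Longrightarrow> s \<noteq> t \<Longrightarrow> s \<ominus> t \<notin> m"
    and L: "\<And>t. t \<in> T \<Longrightarrow> ideal (L t) R" "\<And>t. t \<in> T \<Longrightarrow> U \<subseteq> L t"
      "\<And>t i. t \<in> T \<Longrightarrow> i < n \<Longrightarrow> u (Suc i) \<ominus> t \<otimes> u i \<in> L t"
  shows "finite {t \<in> T. u 0 \<notin> L t}"
proof (rule ccontr)
  assume "infinite {t \<in> T. u 0 \<notin> L t}"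
  from infinite_countable_subset[OF this] obtain s :: "nat \<Rightarrow> 'a" where
    s: "inj s" "range s \<subseteq> {t \<in> T. u 0 \<notin> L t}" by blast
  have sT: "s j \<in> T" and s0: "u 0 \<notin> L (s j)" and sc: "s j \<in> carrier R" for j
    using s(2) T(1) by auto
  interpret U: ideal U R by fact
  have iG: "ideal (Idl G) R" using G by (intro genideal_ideal)
  define E where "E = Idl G <+> U"
  have iE: "ideal E R" unfolding E_def using iG U.is_ideal by (rule add_ideals)
  interpret E: ideal E R by fact
  \<comment> \<open>With \<open>S\<close> the shift of sequences, \<open>v j\<close> is
    \<open>(S - s_(j-1)) ... (S - s_0) u\<close>, the Newton product as an operator. The value
    \<open>v j i\<close> involves \<open>u i, ..., u (i + j)\<close>, whence the bounds
    \<open>i + j \<le> n\<close> below.\<close>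
  define v where "v = rec_nat u (\<lambda>j w i. w (Suc i) \<ominus> s j \<otimes> w i)"
  have v_0: "v 0 i = u i" and v_Suc: "v (Suc j) i = v j (Suc i) \<ominus> s j \<otimes> v j i" for j i
    by (simp_all add: v_def)
  have vE: "v j i \<in> E" if "i + j \<le> n" for i j
    using that
  proof (induct j arbitrary: i)
    case 0
    then show ?case using u by (simp add: v_0 E_def)
  next
    case (Suc j)
    then have "v j (Suc i) \<in> E" "v j i \<in> E" by auto
    then show ?case using sc by (simp add: v_Suc a_minus_def E.I_l_closed)
  qed
  have vc: "v j i \<in> carrier R" if "i + j \<le> n" for i j using vE[OF that] by (rule E.Icarr)
  have vL: "v j (Suc i) \<ominus> t \<otimes> v j i \<in> L t" if "Suc i + j \<le> n" "t \<in> T" for i j t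
    using that(1)
  proof (induct j arbitrary: i)
    case 0
    then show ?case using L(3)[OF that(2)] by (simp add: v_0)
  next
    case (Suc j)
    interpret L: ideal "L t" R using L(1) that(2) .
    have t: "t \<in> carrier R" using T that by auto
    have c: "v j (Suc (Suc i)) \<in> carrier R" "v j (Suc i) \<in> carrier R" "v j i \<in> carrier R"
      using Suc.prems by (auto intro: vc)
    have "v (Suc j) (Suc i) \<ominus> t \<otimes> v (Suc j) i
      = (v j (Suc (Suc i)) \<ominus> t \<otimes> v j (Suc i)) \<ominus> s j \<otimes> (v j (Suc i) \<ominus> t \<otimes> v j i)"
      unfolding v_Suc using c t sc[of j] by algebra
    moreover have "v j (Suc (Suc i)) \<ominus> t \<otimes> v j (Suc i) \<in> L t" "v j (Suc i) \<ominus> t \<otimes> v j i \<in> L t"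
      using Suc by auto
    ultimately show ?case using sc by (simp add: a_minus_def L.I_l_closed)
  qed
  have in_L: "v j i \<in> L (s l)" if "l < j" "i + j \<le> n" for i j l
    using that
  proof (induct j arbitrary: i)
    case (Suc j)
    interpret L: ideal "L (s l)" R using L(1) sT .
    show ?case
    proof (cases "l = j")
      case True
      then show ?thesis using vL[of i j "s j"] Suc.prems sT by (simp add: v_Suc)
    next
      case False
      then have "v j (Suc i) \<in> L (s l)" "v j i \<in> L (s l)" using Suc by auto
      then show ?thesis using sc by (simp add: v_Suc a_minus_def L.I_l_closed)
    qed
  qed simp
  have notin_L: "v j 0 \<notin> L (s l)" if "j \<le> l" "j \<le> n" for j l
    using that
  proof (induct j)
    case 0
    then show ?case using s0 by (simp add: v_0)
  next
    case (Suc j)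
    interpret L: ideal "L (s l)" R using L(1) sT .
    have c: "v j (Suc 0) \<in> carrier R" "v j 0 \<in> carrier R" using Suc.prems by (auto intro: vc)
    show ?case
    proof
      assume a: "v (Suc j) 0 \<in> L (s l)"
      have b: "v j (Suc 0) \<ominus> s l \<otimes> v j 0 \<in> L (s l)" using vL[of 0 j] Suc.prems sT by simp
      have "v (Suc j) 0 \<ominus> (v j (Suc 0) \<ominus> s l \<otimes> v j 0) = (s l \<ominus> s j) \<otimes> v j 0"
        unfolding v_Suc using c sc[of l] sc[of j] by algebra
      moreover have "v (Suc j) 0 \<ominus> (v j (Suc 0) \<ominus> s l \<otimes> v j 0) \<in> L (s l)"
        using a b by (simp add: a_minus_def)
      ultimately have "(s l \<ominus> s j) \<otimes> v j 0 \<in> L (s l)" by simp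
      moreover have "s l \<noteq> s j" using s(1) Suc.prems by (auto simp: inj_eq)
      then have "s l \<ominus> s j \<notin> m" by (rule T(2)[OF sT sT])
      ultimately have "v j 0 \<in> L (s l)"
        using unit_mult_cancel_ideal[OF L.is_ideal minus_closed[OF sc sc] _ c(2)] by blast
      then show False using Suc by simp
    qed
  qed
  define D where "D k = E \<inter> (\<Inter>l<k. L (s l))" for k
  have iD: "ideal (D k) R" for k
  proof -
    have e: "D k = \<Inter>(insert E ((\<lambda>l. L (s l)) ` {..<k}))" by (auto simp: D_def)
    show ?thesis unfolding e by (rule i_Intersect) (use iE L(1)[OF sT] in auto)
  qed
  have UD: "U \<subseteq> D k" for k
    using L(2)[OF sT] set_add_upper[OF iG U.is_ideal] by (auto simp: D_def E_def)
  \<comment> \<open>The elements \<open>v 0 0, ..., v n 0\<close> separate consecutive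
    \<open>D k\<close>. These are \<open>n + 1\<close> drops from a dimension of at most
    \<open>n\<close>, and they use \<open>u\<close> exactly up to index \<open>n\<close>.\<close>
  have "\<exists>W. finite W \<and> W \<subseteq> carrier R \<and> D k = Idl W <+> U \<and> card W + k \<le> card G" if "k \<le> Suc n" for k
    using that
  proof (induct k)
    case 0
    then show ?case using G by (auto simp: D_def E_def)
  next
    case (Suc k)
    then obtain W where W: "finite W" "W \<subseteq> carrier R" "D k = Idl W <+> U" "card W + k \<le> card G"
      by auto
    have iW: "ideal (Idl W) R" using W by (intro genideal_ideal)
    have mE: "m \<cdot> E \<subseteq> U"
      unfolding E_def ideal_prod_distr(1)[OF m_ideal iG U.is_ideal]
      using U(2) ideal_prod_inter[OF m_ideal U.is_ideal] by (intro set_add_subsetI U.is_ideal) auto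
    have "m \<cdot> (Idl W) \<subseteq> m \<cdot> E"
      using set_add_upper[OF iW U.is_ideal] W(3) by (intro ideal_prod_mono m_ideal iE) (auto simp: D_def)
    then have mW: "m \<cdot> (Idl W) \<subseteq> U" using mE by blast
    have DD: "D (Suc k) \<subseteq> D k" by (auto simp: D_def)
    have "v k 0 \<in> D k" using in_L[of _ k 0] vE[of 0 k] Suc.prems by (auto simp: D_def)
    moreover have "v k 0 \<notin> D (Suc k)" using notin_L[of k k] Suc.prems by (auto simp: D_def)
    ultimately have "D (Suc k) \<noteq> D k" by auto
    then obtain V where "finite V" "V \<subseteq> carrier R" "D (Suc k) = Idl V <+> U" "card V < card W"
      using subspace_generators[OF W(1,2) U.is_ideal mW iD UD, of "Suc k"] DD W(3) by auto
    then show ?case using W(4) by auto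
  qed
  from this[OF le_refl] obtain W :: "'a set" where "card W + Suc n \<le> card G" by blast
  then show False using G(3) by linarith
qed

section \<open>Reductions modulo an ideal\<close>

abbreviation pw :: "nat \<Rightarrow> 'a set" where "pw \<equiv> ideal_pow R m"

text \<open>The reduction equation of \<open>R Quot I\<close>, pulled back to \<open>R\<close> so
  that one \<open>Q\<close> can be tested against several \<open>I\<close>. One inclusion is enough
  because the other is automatic for \<open>Q \<subseteq> m\<close>.\<close>

definition red_at :: "'a set \<Rightarrow> 'a set \<Rightarrow> nat \<Rightarrow> bool" where
  "red_at I Q r \<longleftrightarrow> pw (Suc r) \<subseteq> Q \<cdot> pw r <+> I"

lemma pw_ideal: "ideal (pw k) R"
  using m_ideal by (rule ideal_pow_ideal)

lemma pw_carrier: "a \<in> pw k \<Longrightarrow> a \<in> carrier R"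
  by (rule ideal.Icarr[OF pw_ideal])

lemma pw_prod: "pw j \<cdot> pw k = pw (j + k)"
  using ideal_pow_add[OF m_ideal] by simp

lemmas ideal_intros = add_ideals ideal_prod_is_ideal pw_ideal m_ideal

lemma red_at_mono:
  assumes "ideal I R" "ideal I' R" "ideal Q R" "ideal Q' R" "red_at I Q r" "I \<subseteq> I'" "Q \<subseteq> Q'"
  shows "red_at I' Q' r"
proof -
  have "Q \<cdot> pw r <+> I \<subseteq> Q' \<cdot> pw r <+> I'"
    using assms by (intro set_add_mono ideal_prod_mono ideal_intros) auto
  then show ?thesis using assms(5) by (auto simp: red_at_def)
qed

lemma red_at_add:
  assumes "ideal I R" "ideal Q R" "red_at I Q r"
  shows "red_at I Q (r + k)"
proof -
  have "pw (Suc (r + k)) = pw (Suc r) \<cdot> pw k" unfolding pw_prod by simp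
  also have "\<dots> \<subseteq> (Q \<cdot> pw r <+> I) \<cdot> pw k"
    using assms by (intro ideal_prod_mono ideal_intros) (auto simp: red_at_def)
  also have "\<dots> \<subseteq> Q \<cdot> pw (r + k) <+> I"
  proof (rule set_add_prod_subsetI)
    show "(Q \<cdot> pw r) \<cdot> pw k \<subseteq> Q \<cdot> pw (r + k) <+> I"
      unfolding ideal_prod_assoc[OF assms(2) pw_ideal pw_ideal] pw_prod
      using assms by (intro set_add_upper(1) ideal_intros)
    have "I \<cdot> pw k \<subseteq> I" using ideal_prod_inter[OF assms(1) pw_ideal] by blast
    also have "\<dots> \<subseteq> Q \<cdot> pw (r + k) <+> I" using assms by (intro set_add_upper(2) ideal_intros)
    finally show "I \<cdot> pw k \<subseteq> Q \<cdot> pw (r + k) <+> I" .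
  qed (use assms in \<open>auto intro!: ideal_intros\<close>)
  finally show ?thesis by (simp add: red_at_def)
qed

lemma red_at_mult:
  assumes "ideal I R" "ideal J R" "ideal K R" "I \<cdot> J \<subseteq> K" "ideal Q R" "Q \<subseteq> m"
    "red_at I Q r" "red_at J Q s"
  shows "red_at K Q (r + s + 1)"
proof -
  let ?K = "Q \<cdot> pw (r + s + 1) <+> K"
  have iK: "ideal ?K R" using assms by (intro ideal_intros)
  interpret K: ideal ?K R by (rule iK)
  have QK: "Q \<cdot> pw (r + s + 1) \<subseteq> ?K" "K \<subseteq> ?K"
    using set_add_upper[of "Q \<cdot> pw (r + s + 1)" K] assms by (auto simp: ideal_intros)
  have Qr: "Q \<cdot> pw k \<subseteq> pw (Suc k)" for k
    using ideal_prod_mono[OF m_ideal pw_ideal assms(6) subset_refl] by simp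
  have 1: "a \<otimes> b \<in> ?K" if a: "a \<in> Q \<cdot> pw j" and b: "b \<in> pw (Suc k)" and jk: "j + k = r + s" for a b j k
  proof -
    have "a \<otimes> b \<in> (Q \<cdot> pw j) \<cdot> pw (Suc k)" using a b by (rule ideal_prod.prod)
    also have "\<dots> = Q \<cdot> pw (r + s + 1)"
      unfolding ideal_prod_assoc[OF assms(5) pw_ideal pw_ideal] pw_prod using jk by simp
    finally show ?thesis using QK by blast
  qed
  have "pw (r + s + 1 + 1) = pw (Suc r) \<cdot> pw (Suc s)" unfolding pw_prod by simp
  also have "\<dots> \<subseteq> ?K"
  proof (rule ideal_prod_subsetI[OF iK])
    fix a b assume ab: "a \<in> pw (Suc r)" "b \<in> pw (Suc s)"
    obtain a1 a2 where a: "a1 \<in> Q \<cdot> pw r" "a2 \<in> I" "a = a1 \<oplus> a2"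
      using ab(1) assms(7) unfolding red_at_def by (meson set_addE subsetD)
    obtain b1 b2 where b: "b1 \<in> Q \<cdot> pw s" "b2 \<in> J" "b = b1 \<oplus> b2"
      using ab(2) assms(8) unfolding red_at_def by (meson set_addE subsetD)
    have c: "a1 \<in> carrier R" "a2 \<in> carrier R" "b1 \<in> carrier R" "b2 \<in> carrier R"
      using a(1,2) b(1,2) Qr[of r] Qr[of s] pw_carrier ideal.Icarr[OF assms(1)] ideal.Icarr[OF assms(2)]
      by blast+
    \<comment> \<open>The product \<open>a2 \<otimes> b1\<close> is controlled because \<open>a2 = a \<ominus> a1\<close> lies in \<open>pw (Suc r)\<close>.\<close>
    have "a2 = a \<ominus> a1" unfolding a(3) using c by algebra
    moreover have "a1 \<in> pw (Suc r)" using a(1) Qr by blast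
    ultimately have a2: "a2 \<in> pw (Suc r)"
      using ab(1) pw_ideal[of "Suc r"]
      by (simp add: a_minus_def additive_subgroup.a_closed additive_subgroup.a_inv_closed ideal.axioms(1) del: ideal_pow.simps)
    \<comment> \<open>Only \<open>a2 \<otimes> b2\<close> uses \<open>I \<cdot> J\<close>. The other
      terms pair \<open>Q \<cdot> pw r\<close> with \<open>pw (Suc s)\<close> and
      \<open>Q \<cdot> pw s\<close> with \<open>pw (Suc r)\<close>, which is the origin of the
      exponent \<open>r + s + 1\<close>.\<close>
    have e: "a \<otimes> b = a1 \<otimes> b \<oplus> (b1 \<otimes> a2 \<oplus> a2 \<otimes> b2)" unfolding a(3) b(3) using c by algebra
    have "a1 \<otimes> b \<in> ?K" using 1[OF a(1) ab(2)] by simp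
    moreover have "b1 \<otimes> a2 \<in> ?K" using 1[OF b(1) a2] by simp
    moreover have "a2 \<otimes> b2 \<in> ?K" using ideal_prod.prod[OF a(2) b(2), of R] assms(4) QK by blast
    ultimately show "a \<otimes> b \<in> ?K" unfolding e by (intro K.a_closed)
  qed
  finally show ?thesis by (simp add: red_at_def)
qed

text \<open>Replacing \<open>Q\<close> by \<open>W\<close> costs a term in
  \<open>m \<cdot> m \<cdot> pw r = m \<cdot> pw (Suc r)\<close>, which Nakayama applied to
  \<open>pw (Suc r)\<close> absorbs without raising \<open>r\<close>. A reduction thus matters only
  up to \<open>m \<cdot> m\<close> and \<open>I\<close>.\<close>

lemma red_at_drop:
  assumes "ideal I R" "ideal Q R" "ideal W R" "red_at I Q r" "Q \<subseteq> W <+> m \<cdot> m <+> I"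
  shows "red_at I W r"
proof -
  let ?K = "W \<cdot> pw r <+> I"
  have iK: "ideal ?K R" using assms by (intro ideal_intros)
  let ?M = "?K <+> m \<cdot> pw (Suc r)"
  have iM: "ideal ?M R" using assms by (intro ideal_intros)
  have u: "W \<cdot> pw r \<subseteq> ?K" "I \<subseteq> ?K" "?K \<subseteq> ?M" "m \<cdot> pw (Suc r) \<subseteq> ?M"
    using set_add_upper[OF ideal_prod_is_ideal[OF assms(3) pw_ideal] assms(1)]
      set_add_upper[OF iK ideal_prod_is_ideal[OF m_ideal pw_ideal]] by blast+
  have "Q \<cdot> pw r \<subseteq> (W <+> m \<cdot> m <+> I) \<cdot> pw r"
    using assms by (intro ideal_prod_mono ideal_intros) auto
  also have "\<dots> \<subseteq> ?M"
  proof (intro set_add_prod_subsetI)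
    show "W \<cdot> pw r \<subseteq> ?M" using u by blast
    show "m \<cdot> m \<cdot> pw r \<subseteq> ?M" using u(4) ideal_prod_assoc[OF m_ideal m_ideal pw_ideal] by simp
    show "I \<cdot> pw r \<subseteq> ?M" using u ideal_prod_inter[OF assms(1) pw_ideal] by blast
  qed (use assms iM in \<open>blast intro: ideal_intros\<close>)+
  finally have "pw (Suc r) \<subseteq> ?M"
    using assms(4) u set_add_subsetI[OF iM, of "Q \<cdot> pw r" I] unfolding red_at_def by blast
  then show ?thesis unfolding red_at_def by (rule nakayama[OF pw_ideal iK])
qed

lemma ideal_Idl: "S \<subseteq> carrier R \<Longrightarrow> ideal (Idl S) R"
  by (rule genideal_ideal)

lemma Idl_subset_m: "S \<subseteq> m \<Longrightarrow> Idl S \<subseteq> m"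
  by (rule genideal_minimal[OF m_ideal])

lemma ideal_prod_left_commute:
  assumes "ideal A R" "ideal B R" "ideal C R"
  shows "A \<cdot> (B \<cdot> C) = B \<cdot> (A \<cdot> C)"
  using assms by (metis ideal_prod_assoc ideal_prod_commute)

section \<open>Merging and exchanging generators of a reduction\<close>

text \<open>Modulo \<open>J\<close> and \<open>I\<close>, multiplication by \<open>x\<close> maps
  each component of the fibre cone, from degree \<open>r + 1\<close> on, onto the next one. The
  number of generators of \<open>pw (Suc r)\<close> therefore bounds all later dimensions.\<close>

lemma bounded_generation:
  assumes I: "ideal I R" and J: "ideal J R" and x: "x \<in> m"
    and red: "red_at I (J <+> Idl {x}) r"
  shows "\<exists>N. \<forall>k. \<exists>W. finite W \<and> W \<subseteq> pw (Suc (r + k)) \<and> card W \<le> N \<and>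
    pw (Suc (r + k)) \<subseteq> Idl W <+> (pw (Suc (Suc (r + k))) <+> J \<cdot> pw (r + k) <+> I)"
proof -
  \<comment> \<open>\<open>V n\<close> is the denominator in degree \<open>Suc n\<close>, hence the
    shift against the power of \<open>m\<close> that it accompanies.\<close>
  define V where "V n = pw (Suc (Suc n)) <+> J \<cdot> pw n <+> I" for n
  have iV: "ideal (V n) R" for n unfolding V_def using I J by (intro ideal_intros)
  have xc: "x \<in> carrier R" using x m_carrier by blast
  have ix: "ideal (Idl {x}) R" using xc by (intro ideal_Idl) auto
  have iJx: "ideal (J <+> Idl {x}) R" using J ix by (rule add_ideals)
  have V1: "pw (Suc (Suc n)) \<subseteq> V n" "J \<cdot> pw n \<subseteq> V n" "I \<subseteq> V n" for n
    unfolding V_def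
    using set_add_upper[OF pw_ideal[of "Suc (Suc n)"] ideal_prod_is_ideal[OF J pw_ideal[of n]]]
      set_add_upper[OF add_ideals[OF pw_ideal[of "Suc (Suc n)"] ideal_prod_is_ideal[OF J pw_ideal[of n]]] I]
    by blast+
  have mV: "m \<cdot> V n \<subseteq> V (Suc n)" for n
  proof -
    have "m \<cdot> V n = (m \<cdot> pw (Suc (Suc n)) <+> m \<cdot> (J \<cdot> pw n)) <+> m \<cdot> I"
      unfolding V_def using I J by (simp only: ideal_prod_distr(1) ideal_intros)
    also have "\<dots> \<subseteq> V (Suc n)"
    proof (intro set_add_subsetI iV)
      show "m \<cdot> pw (Suc (Suc n)) \<subseteq> V (Suc n)" using V1(1)[of "Suc n"] by simp
      show "m \<cdot> (J \<cdot> pw n) \<subseteq> V (Suc n)"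
        using V1(2)[of "Suc n"] unfolding ideal_prod_left_commute[OF m_ideal J pw_ideal] by simp
      show "m \<cdot> I \<subseteq> V (Suc n)" using V1(3) ideal_prod_inter[OF m_ideal I] by blast
    qed
    finally show ?thesis .
  qed
  obtain G where G: "G \<subseteq> carrier R" "finite G" "pw (Suc r) = Idl G"
    using finetely_gen[OF pw_ideal] by blast
  have "\<exists>W. finite W \<and> W \<subseteq> pw (Suc (r + k)) \<and> card W \<le> card G \<and> pw (Suc (r + k)) \<subseteq> Idl W <+> V (r + k)" for k
  proof (induct k)
    case 0
    have "G \<subseteq> pw (Suc r)" unfolding G(3) by (rule genideal_self[OF G(1)])
    moreover have "pw (Suc r) \<subseteq> Idl G <+> V r"
      unfolding G(3) using ideal_Idl[OF G(1)] iV by (rule set_add_upper)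
    ultimately show ?case using G(2) by (intro exI[of _ G]) (simp del: ideal_pow.simps)
  next
    case (Suc k)
    define n where "n = Suc (r + k)"
    obtain W where W: "finite W" "W \<subseteq> pw n" "card W \<le> card G" "pw n \<subseteq> Idl W <+> V (r + k)"
      using Suc unfolding n_def by blast
    have Wc: "W \<subseteq> carrier R" using W(2) pw_carrier by blast
    define W' where "W' = (\<lambda>w. x \<otimes> w) ` W"
    have W'p: "W' \<subseteq> pw (Suc n)" unfolding W'_def using W(2) x by (auto intro: ideal_prod.prod)
    have W'c: "W' \<subseteq> carrier R" using W'p pw_carrier by blast
    let ?K = "Idl W' <+> V n"
    have iK: "ideal ?K R" using ideal_Idl[OF W'c] iV by (rule add_ideals)
    interpret K: ideal ?K R by (rule iK)
    have K1: "Idl W' \<subseteq> ?K" "V n \<subseteq> ?K" using set_add_upper[OF ideal_Idl[OF W'c] iV] by blast+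
    have WW': "(Idl W) \<cdot> (Idl {x}) \<subseteq> Idl W'"
    proof (rule Idl_prod_subsetI[OF Wc ix ideal_Idl[OF W'c]])
      fix w c assume w: "w \<in> W" and c: "c \<in> Idl {x}"
      obtain b where b: "b \<in> carrier R" "c = b \<otimes> x" by (rule Idl_singleton_memE[OF c xc])
      have "w \<otimes> c = b \<otimes> (x \<otimes> w)" unfolding b(2) using b(1) xc w Wc by (simp add: m_ac subset_iff)
      moreover have "x \<otimes> w \<in> Idl W'" using w genideal_self[OF W'c] by (auto simp: W'_def)
      ultimately show "w \<otimes> c \<in> Idl W'" using b(1) by (simp add: ideal.I_l_closed[OF ideal_Idl[OF W'c]])
    qed
    have "(Idl {x}) \<cdot> pw n \<subseteq> ?K"
    proof (rule Idl_prod_subsetI[OF _ pw_ideal iK])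
      fix s c assume s: "s \<in> {x}" and c: "c \<in> pw n"
      then obtain w v where wv: "w \<in> Idl W" "v \<in> V (r + k)" "c = w \<oplus> v" using W(4) by (meson set_addE subsetD)
      have wc: "w \<in> carrier R" "v \<in> carrier R"
        using ideal.Icarr[OF ideal_Idl[OF Wc] wv(1)] ideal.Icarr[OF iV wv(2)] .
      have "w \<otimes> x \<in> ?K" using WW' K1 ideal_prod.prod[OF wv(1) genideal_self'[OF xc], of R] by auto
      moreover have "x \<otimes> v \<in> ?K" using mV[of "r + k"] K1 ideal_prod.prod[OF x wv(2), of R] by (auto simp: n_def)
      moreover have "s \<otimes> c = w \<otimes> x \<oplus> x \<otimes> v" using s wc xc unfolding wv(3) by (simp add: r_distr m_comm)
      ultimately show "s \<otimes> c \<in> ?K" by simp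
    qed (use xc in auto)
    moreover have "J \<cdot> pw n \<subseteq> ?K" using V1 K1 by blast
    ultimately have "(J <+> Idl {x}) \<cdot> pw n \<subseteq> ?K"
      by (intro set_add_prod_subsetI[OF J ix pw_ideal iK]) auto
    moreover have "pw (Suc n) \<subseteq> (J <+> Idl {x}) \<cdot> pw n <+> I"
      using red_at_add[OF I iJx red, of "Suc k"] by (simp add: red_at_def n_def)
    ultimately have "pw (Suc n) \<subseteq> ?K"
      using set_add_subsetI[OF iK, of _ I] V1(3) K1(2) by (meson order_trans)
    moreover have "card W' \<le> card G" using card_image_le[OF W(1), of "\<lambda>w. x \<otimes> w"] W(3) by (simp add: W'_def)
    ultimately show ?case using W(1) W'p
      by (intro exI[of _ W']) (simp add: n_def W'_def del: ideal_pow.simps)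
  qed
  then show ?thesis unfolding V_def by blast
qed

text \<open>The relation \<open>pw (Suc p) \<subseteq> L \<cdot> pw p <+> (Idl {z}) \<cdot> pw p <+>
  I\<close> is iterated. A factor \<open>pw p\<close> is held back beside the power of
  \<open>z\<close>: multiplied by \<open>m\<close> it becomes \<open>pw (Suc p)\<close> and the
  relation applies again, while powers of \<open>z\<close> falling on the \<open>L\<close> term
  count as powers of \<open>m\<close>.\<close>

lemma pw_subset_power_of_generator:
  assumes I: "ideal I R" and L: "ideal L R" and z: "z \<in> m" and red: "red_at I (L <+> Idl {z}) p"
  shows "pw (p + Suc j) \<subseteq> L \<cdot> pw (p + j) <+> (Idl {z [^] Suc j}) \<cdot> pw p <+> I"
proof (induct j)
  have zc: "z \<in> carrier R" using z m_carrier by blast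
  have iz: "ideal (Idl {z [^] (j::nat)}) R" for j using zc by (intro ideal_Idl) auto
  have iz1: "ideal (Idl {z}) R" using zc by (intro ideal_Idl) auto
  have red': "pw (Suc p) \<subseteq> L \<cdot> pw p <+> (Idl {z}) \<cdot> pw p <+> I"
    using red unfolding red_at_def ideal_prod_distr(2)[OF pw_ideal L iz1] .
  {
    case 0
    then show ?case using red' zc by simp
  next
    case (Suc j)
    let ?w = "z [^] Suc j"
    have wc: "?w \<in> carrier R" using zc by simp
    let ?K = "L \<cdot> pw (p + Suc j) <+> (Idl {z [^] Suc (Suc j)}) \<cdot> pw p <+> I"
    have iLK: "ideal (L \<cdot> pw (p + Suc j)) R" "ideal ((Idl {z [^] Suc (Suc j)}) \<cdot> pw p) R"
      using L iz[of "Suc (Suc j)"] by (simp_all only: ideal_intros)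
    have iK: "ideal ?K R" using iLK I by (intro add_ideals)
    interpret K: ideal ?K R by (rule iK)
    have K1: "L \<cdot> pw (p + Suc j) \<subseteq> ?K" "(Idl {z [^] Suc (Suc j)}) \<cdot> pw p \<subseteq> ?K" "I \<subseteq> ?K"
      using set_add_upper[OF iLK] set_add_upper[OF add_ideals[OF iLK] I] by blast+
    have wL: "pw (Suc j) \<cdot> (L \<cdot> pw p) = L \<cdot> pw (p + Suc j)"
      unfolding ideal_prod_left_commute[OF pw_ideal L pw_ideal] pw_prod by (simp add: add.commute)
    have "(Idl {?w}) \<cdot> pw (Suc p) \<subseteq> ?K"
    proof (rule Idl_prod_subsetI[OF _ pw_ideal iK])
      fix s c assume s: "s \<in> {?w}" and c: "c \<in> pw (Suc p)"
      from c red' obtain d i where di: "d \<in> L \<cdot> pw p <+> (Idl {z}) \<cdot> pw p" "i \<in> I" "c = d \<oplus> i"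
        by (meson set_addE subsetD)
      from di(1) obtain c1 c2 where c12: "c1 \<in> L \<cdot> pw p" "c2 \<in> (Idl {z}) \<cdot> pw p" "d = c1 \<oplus> c2"
        by (rule set_addE)
      have cc: "c1 \<in> carrier R" "c2 \<in> carrier R" "i \<in> carrier R"
        using ideal.Icarr[OF ideal_prod_is_ideal[OF L pw_ideal] c12(1)]
          ideal.Icarr[OF ideal_prod_is_ideal[OF iz1 pw_ideal] c12(2)] ideal.Icarr[OF I di(2)] .
      have "?w \<otimes> c1 \<in> ?K"
        using ideal_prod.prod[OF nat_pow_mem_ideal_pow[OF m_ideal z, of "Suc j"] c12(1), of R] wL K1(1) by blast
      moreover have "?w \<otimes> i \<in> ?K" using K1(3) ideal.I_l_closed[OF I di(2) wc] by blast
      moreover have "?w \<otimes> c2 \<in> ?K"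
      proof -
        have "(Idl {?w}) \<cdot> (Idl {z}) \<subseteq> Idl {z [^] Suc (Suc j)}"
        proof (rule Idl_prod_subsetI[OF _ iz1 iz])
          fix s c assume s: "s \<in> {?w}" and c: "c \<in> Idl {z}"
          obtain b where b: "b \<in> carrier R" "c = b \<otimes> z" by (rule Idl_singleton_memE[OF c zc])
          have "?w \<otimes> c = b \<otimes> (?w \<otimes> z)" unfolding b(2) by (rule m_lcomm[OF wc b(1) zc])
          moreover have "?w \<otimes> z = z [^] Suc (Suc j)" by simp
          ultimately have "s \<otimes> c = b \<otimes> z [^] Suc (Suc j)" using s by (simp only: singleton_iff)
          then show "s \<otimes> c \<in> Idl {z [^] Suc (Suc j)}"
            using ideal.I_l_closed[OF iz genideal_self'[OF nat_pow_closed[OF zc]] b(1)] by (simp only:)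
        qed (use zc in auto)
        then have "((Idl {?w}) \<cdot> (Idl {z})) \<cdot> pw p \<subseteq> (Idl {z [^] Suc (Suc j)}) \<cdot> pw p"
          by (intro ideal_prod_mono iz pw_ideal) auto
        then have "(Idl {?w}) \<cdot> ((Idl {z}) \<cdot> pw p) \<subseteq> ?K"
          using K1(2) unfolding ideal_prod_assoc[OF iz iz1 pw_ideal] by blast
        then show ?thesis using ideal_prod.prod[OF genideal_self'[OF wc] c12(2), of R] by blast
      qed
      moreover have "s \<otimes> c = ?w \<otimes> c1 \<oplus> (?w \<otimes> c2 \<oplus> ?w \<otimes> i)"
        using s cc wc unfolding di(3) c12(3) by (simp add: r_distr a_assoc del: nat_pow_Suc)
      ultimately show "s \<otimes> c \<in> ?K" by (simp only: K.a_closed)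
    qed (use wc in auto)
    then have w: "m \<cdot> ((Idl {?w}) \<cdot> pw p) \<subseteq> ?K"
      unfolding ideal_prod_left_commute[OF m_ideal iz pw_ideal] by simp
    have "pw (p + Suc (Suc j)) = m \<cdot> pw (p + Suc j)" by simp
    also have "\<dots> \<subseteq> m \<cdot> (L \<cdot> pw (p + j) <+> (Idl {?w}) \<cdot> pw p <+> I)"
      by (intro ideal_prod_mono ideal_intros subset_refl Suc I L iz)
    also have "\<dots> = m \<cdot> (L \<cdot> pw (p + j)) <+> m \<cdot> ((Idl {?w}) \<cdot> pw p) <+> m \<cdot> I"
      using I L iz[of "Suc j"] by (simp only: ideal_prod_distr(1) ideal_intros)
    also have "\<dots> \<subseteq> ?K"
    proof (intro set_add_subsetI iK w)
      show "m \<cdot> (L \<cdot> pw (p + j)) \<subseteq> ?K"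
        using K1(1) unfolding ideal_prod_left_commute[OF m_ideal L pw_ideal] by simp
      show "m \<cdot> I \<subseteq> ?K" using K1(3) ideal_prod_inter[OF m_ideal I] by blast
    qed
    finally show ?case .
  }
qed

end

locale noetherian_local_ring_inf = noetherian_local_ring +
  assumes infinite_residue_field: "infinite (carrier (R Quot m))"
begin

text \<open>Parameters are taken among lifts of residues: distinct ones differ by a unit, and they
  can still multiply elements of \<open>R\<close>.\<close>

lemma residue_representatives:
  obtains T where "T \<subseteq> carrier R" "infinite T" "\<And>s t. s \<in> T \<Longrightarrow> t \<in> T \<Longrightarrow> s \<noteq> t \<Longrightarrow> s \<ominus> t \<notin> m"
proof -
  have ex: "\<exists>a. a \<in> carrier R \<and> m +> a = c" if "c \<in> carrier (R Quot m)" for c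
    using that by (auto simp: FactRing_def A_RCOSETS_def')
  define f where "f c = (SOME a. a \<in> carrier R \<and> m +> a = c)" for c
  have f: "f c \<in> carrier R" "m +> f c = c" if "c \<in> carrier (R Quot m)" for c
    using someI_ex[OF ex[OF that]] by (auto simp: f_def)
  have "inj_on f (carrier (R Quot m))" by (rule inj_onI) (metis f(2))
  then have "infinite (f ` carrier (R Quot m))" using infinite_residue_field finite_imageD by blast
  moreover have "s \<ominus> t \<notin> m"
    if mem: "s \<in> f ` carrier (R Quot m)" "t \<in> f ` carrier (R Quot m)" "s \<noteq> t" for s t
  proof
    assume st: "s \<ominus> t \<in> m"
    obtain c d where cd: "c \<in> carrier (R Quot m)" "d \<in> carrier (R Quot m)" "s = f c" "t = f d"
      using mem(1,2) by blast
    have "m +> f c = m +> f d"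
      using st quotient_eq_iff_same_a_r_cos[OF m_ideal f(1)[OF cd(1)] f(1)[OF cd(2)]] cd(3,4) by simp
    then have "c = d" using f(2)[OF cd(1)] f(2)[OF cd(2)] by simp
    with cd(3,4) mem(3) show False by simp
  qed
  moreover have "f ` carrier (R Quot m) \<subseteq> carrier R" using f(1) by blast
  ultimately show thesis using that by metis
qed

text \<open>If \<open>J <+> Idl {x}\<close> is a reduction, the fibre cone modulo \<open>J\<close> has components of bounded
  dimension, so the monomials of a large degree \<open>n\<close> in \<open>y, z\<close> are dependent, and for all but
  finitely many \<open>t\<close> this dependency expresses \<open>z\<^sup>n\<close> through \<open>y \<ominus> t \<otimes> z\<close>.\<close>

lemma merge_generators:
  assumes I: "ideal I R" and J: "ideal J R" and x: "x \<in> m" and red: "red_at I (J <+> Idl {x}) r"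
    and L: "ideal L R" "J \<subseteq> L" and yz: "y \<in> m" "z \<in> m"
    and redp: "red_at I (L <+> Idl {y} <+> Idl {z}) p"
  obtains a q where "a \<in> carrier R" "red_at I (L <+> Idl {y \<ominus> a \<otimes> z}) q"
proof -
  obtain N where N: "\<And>k. \<exists>W. finite W \<and> W \<subseteq> pw (Suc (r + k)) \<and> card W \<le> N \<and>
    pw (Suc (r + k)) \<subseteq> Idl W <+> (pw (Suc (Suc (r + k))) <+> J \<cdot> pw (r + k) <+> I)"
    using bounded_generation[OF I J x red] by blast
  \<comment> \<open>The degree \<open>n = r + N + 1\<close> is past \<open>r\<close>, where the
    bound \<open>N\<close> holds, and exceeds \<open>N\<close>, so the \<open>n + 1\<close>
    monomials outnumber the dimension.\<close>
  define n' where "n' = r + N"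
  define n where "n = Suc n'"
  define U where "U = pw (Suc n) <+> J \<cdot> pw n' <+> I"
  obtain W where W: "finite W" "W \<subseteq> pw n" "card W \<le> N" "pw n \<subseteq> Idl W <+> U"
    using N[of N] unfolding U_def n_def n'_def by blast
  have iU1: "ideal (pw (Suc n) <+> J \<cdot> pw n') R" using J by (intro ideal_intros)
  have iU: "ideal U R" unfolding U_def using iU1 I by (rule add_ideals)
  have U1: "pw (Suc n) \<subseteq> U" "J \<cdot> pw n' \<subseteq> U" "I \<subseteq> U"
    using set_add_upper[OF pw_ideal[of "Suc n"] ideal_prod_is_ideal[OF J pw_ideal[of n']]]
      set_add_upper[OF iU1 I] unfolding U_def by blast+
  have yzc: "y \<in> carrier R" "z \<in> carrier R" using yz m_carrier by blast+
  obtain T where T: "T \<subseteq> carrier R" "infinite T" "\<And>s t. s \<in> T \<Longrightarrow> t \<in> T \<Longrightarrow> s \<noteq> t \<Longrightarrow> s \<ominus> t \<notin> m"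
    using residue_representatives by metis
  define h where "h t = y \<ominus> t \<otimes> z" for t
  have hc: "h t \<in> carrier R" if "t \<in> carrier R" for t using that yzc by (simp add: h_def)
  have ih: "ideal (Idl {h t}) R" if "t \<in> carrier R" for t using hc[OF that] by (intro ideal_Idl) auto
  \<comment> \<open>Modulo \<open>h t\<close> the element \<open>y\<close> may be replaced by
    \<open>t \<otimes> z\<close>, so each monomial is \<open>t\<close> times its predecessor. The
    first one, \<open>u 0\<close>, is the power of \<open>z\<close> to be eliminated.\<close>
  define u where "u i = y [^] i \<otimes> z [^] (n - i)" for i
  define Lt where "Lt t = (Idl {h t}) \<cdot> pw n' <+> U" for t
  have iLt: "ideal (Lt t) R" if "t \<in> carrier R" for t
    unfolding Lt_def using ih[OF that] iU by (intro ideal_intros)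
  have Lt1: "(Idl {h t}) \<cdot> pw n' \<subseteq> Lt t" "U \<subseteq> Lt t" if "t \<in> carrier R" for t
    unfolding Lt_def using set_add_upper[OF ideal_prod_is_ideal[OF ih[OF that] pw_ideal] iU] by blast+
  have "finite {t \<in> T. u 0 \<notin> Lt t}"
  proof (rule geometric_mod_pencil_finite[where n = n and G = W and U = U])
    show "finite W" "W \<subseteq> carrier R" "card W \<le> n" "ideal U R"
      using W pw_carrier iU by (auto simp: n_def n'_def simp del: ideal_pow.simps)
    have "Idl W \<subseteq> pw n" using W(2) by (rule genideal_minimal[OF pw_ideal])
    then have "m \<cdot> (Idl W) \<subseteq> pw (Suc n)"
      using ideal_prod_mono[OF m_ideal pw_ideal subset_refl, of "Idl W" n] by simp
    then show "m \<cdot> (Idl W) \<subseteq> U" using U1 by blast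
    show "u i \<in> Idl W <+> U" if "i \<le> n" for i
    proof -
      have "u i \<in> pw (i + (n - i))" unfolding u_def
        by (intro ideal_pow_mult_closed nat_pow_mem_ideal_pow m_ideal yz)
      then show ?thesis using that W(4) by auto
    qed
    show "ideal (Lt t) R" "U \<subseteq> Lt t" if "t \<in> T" for t using that T(1) iLt Lt1 by blast+
    show "u (Suc i) \<ominus> t \<otimes> u i \<in> Lt t" if t: "t \<in> T" and i: "i < n" for t i
    proof -
      have tc: "t \<in> carrier R" using t T(1) by blast
      define w where "w = y [^] i \<otimes> z [^] (n - Suc i)"
      have "w \<in> pw (i + (n - Suc i))" unfolding w_def
        by (intro ideal_pow_mult_closed nat_pow_mem_ideal_pow m_ideal yz)
      then have "w \<in> pw n'" using i by (simp add: n_def)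
      then have "h t \<otimes> w \<in> Lt t"
        using Lt1(1)[OF tc] ideal_prod.prod[OF genideal_self'[OF hc[OF tc]], of w "pw n'" R] by blast
      moreover have "u (Suc i) \<ominus> t \<otimes> u i = h t \<otimes> w"
      proof -
        have "n - i = Suc (n - Suc i)" using i by simp
        then have ui: "u i = y [^] i \<otimes> (z [^] (n - Suc i) \<otimes> z)" unfolding u_def by simp
        have c: "y [^] i \<in> carrier R" "z [^] (n - Suc i) \<in> carrier R" using yzc by auto
        show ?thesis unfolding ui unfolding u_def w_def h_def nat_pow_Suc
          using c yzc tc by algebra
      qed
      ultimately show ?thesis by simp
    qed
  qed (use T in auto)
  then have "infinite (T - {t \<in> T. u 0 \<notin> Lt t})" using T(2) by (rule Diff_infinite_finite)
  then obtain a where "a \<in> T - {t \<in> T. u 0 \<notin> Lt t}" using infinite_imp_nonempty by blast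
  then have a: "a \<in> carrier R" "u 0 \<in> Lt a" using T(1) by auto
  define L' where "L' = L <+> Idl {h a}"
  have iL': "ideal L' R" unfolding L'_def using L(1) ih[OF a(1)] by (rule add_ideals)
  have L'1: "L \<subseteq> L'" "Idl {h a} \<subseteq> L'" unfolding L'_def using set_add_upper[OF L(1) ih[OF a(1)]] .
  have iz: "ideal (Idl {z}) R" "ideal (Idl {y}) R" using yzc by (auto intro: ideal_Idl)
  \<comment> \<open>Since \<open>y = h a \<oplus> a \<otimes> z\<close>, trading \<open>y\<close>
    for \<open>h a\<close> is harmless as long as \<open>z\<close> is kept; \<open>z\<close> is
    removed afterwards through its \<open>n\<close>-th power.\<close>
  have "red_at I (L' <+> Idl {z}) p"
  proof (rule red_at_mono[OF I I _ _ redp subset_refl])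
    show "ideal (L <+> Idl {y} <+> Idl {z}) R" "ideal (L' <+> Idl {z}) R"
      using iL' L(1) iz by (auto intro!: add_ideals)
    note i = set_add_upper[OF iL' iz(1)]
    have 1: "h a \<in> L' <+> Idl {z}" using L'1 i genideal_self'[OF hc[OF a(1)]] by blast
    have 2: "a \<otimes> z \<in> L' <+> Idl {z}"
      using i genideal_self'[OF yzc(2)] ideal.I_l_closed[OF iz(1) _ a(1)] by blast
    interpret K: ideal "L' <+> Idl {z}" R by fact
    have "h a \<oplus> a \<otimes> z = y" unfolding h_def using a(1) yzc by algebra
    then have "y \<in> L' <+> Idl {z}" using K.a_closed[OF 1 2] by simp
    then show "L <+> Idl {y} <+> Idl {z} \<subseteq> L' <+> Idl {z}"
      using L'1 i genideal_self'[OF yzc(2)] by (intro set_add_subsetI K.is_ideal genideal_minimal) auto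
  qed
  from pw_subset_power_of_generator[OF I iL' yz(2) this, of n']
  have P: "pw (p + n) \<subseteq> L' \<cdot> pw (p + n') <+> (Idl {z [^] n}) \<cdot> pw p <+> I" by (simp only: n_def)
  let ?K = "L' \<cdot> pw (p + n') <+> I"
  have iK: "ideal ?K R" using iL' I by (intro ideal_intros)
  have K1: "L' \<cdot> pw (p + n') \<subseteq> ?K" "I \<subseteq> ?K" using set_add_upper[OF ideal_prod_is_ideal[OF iL' pw_ideal] I] .
  let ?M = "?K <+> m \<cdot> pw (p + n)"
  have iM: "ideal ?M R" using iL' I by (intro ideal_intros)
  have M1: "?K \<subseteq> ?M" "m \<cdot> pw (p + n) \<subseteq> ?M"
    using set_add_upper[OF iK ideal_prod_is_ideal[OF m_ideal pw_ideal]] by blast+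
  have LM: "(L' \<cdot> pw n') \<cdot> pw p \<subseteq> ?M"
    using K1(1) M1(1) unfolding ideal_prod_assoc[OF iL' pw_ideal pw_ideal] pw_prod
    by (simp add: add.commute)
  \<comment> \<open>After multiplication by \<open>pw p\<close>, the parts of \<open>Lt a\<close>
    coming from \<open>h a\<close>, \<open>J\<close> and \<open>I\<close> fall into
    \<open>?K\<close>. Only \<open>pw (Suc n)\<close> leaves an error, and that is one power of
    \<open>m\<close> higher, as Nakayama requires.\<close>
  have "Lt a \<cdot> pw p \<subseteq> ?M"
    unfolding Lt_def U_def
  proof (intro set_add_prod_subsetI)
    show "((Idl {h a}) \<cdot> pw n') \<cdot> pw p \<subseteq> ?M"
      by (rule order_trans[OF _ LM]) (intro ideal_prod_mono L'1 subset_refl iL' pw_ideal ideal_prod_is_ideal)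
    show "(J \<cdot> pw n') \<cdot> pw p \<subseteq> ?M"
      by (rule order_trans[OF _ LM])
        (intro ideal_prod_mono order_trans[OF L(2) L'1(1)] subset_refl iL' pw_ideal ideal_prod_is_ideal)
    show "pw (Suc n) \<cdot> pw p \<subseteq> ?M" using M1(2) unfolding pw_prod by (simp add: add.commute)
    show "I \<cdot> pw p \<subseteq> ?M" using ideal_prod_inter[OF I pw_ideal] K1(2) M1(1) by blast
  qed (use ih[OF a(1)] J I iM iL' in \<open>blast intro: ideal_intros\<close>)+
  moreover have "(Idl {z [^] n}) \<cdot> pw p \<subseteq> Lt a \<cdot> pw p"
  proof (intro ideal_prod_mono iLt[OF a(1)] pw_ideal subset_refl genideal_minimal)
    show "{z [^] n} \<subseteq> Lt a" using a(2) yzc by (simp add: u_def)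
  qed
  ultimately have "pw (p + n) \<subseteq> ?M"
    using P K1 M1(1) set_add_subsetI[OF iM] by (meson order_trans)
  then have "pw (p + n) \<subseteq> ?K" by (rule nakayama[OF pw_ideal iK])
  then have "red_at I L' (p + n')" by (simp add: red_at_def n_def)
  with that a(1) show thesis unfolding L'_def h_def by blast
qed

text \<open>Steinitz exchange: \<open>x\<close> gives way to a single element of the ideal of a
  second reduction. The elements of \<open>Y\<close> are merged into \<open>y\<close> one by one,
  those not yet treated waiting in \<open>L\<close>.\<close>

lemma exchange:
  assumes I: "ideal I R" and J: "ideal J R" and x: "x \<in> m" and red: "red_at I (J <+> Idl {x}) r"
    and Y: "finite Y" "Y \<subseteq> m" and y: "y \<in> m" and redY: "red_at I (J <+> Idl (insert y Y)) p"
  shows "\<exists>y' q. y' \<in> Idl (insert y Y) \<and> red_at I (J <+> Idl {y'}) q"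
  using Y y redY
proof (induct Y arbitrary: y p rule: finite_induct)
  case empty
  then show ?case using genideal_self'[OF m_carrier] by blast
next
  case (insert z Y)
  have c: "y \<in> carrier R" "z \<in> carrier R" "Y \<subseteq> carrier R" using insert m_carrier by auto
  have i: "ideal (Idl Y) R" "ideal (Idl {y}) R" "ideal (Idl {z}) R" "ideal (Idl (insert y (insert z Y))) R"
    using c by (auto intro!: ideal_Idl)
  define L where "L = J <+> Idl Y"
  have iL: "ideal L R" unfolding L_def using J i(1) by (rule add_ideals)
  have L1: "J \<subseteq> L" "Idl Y \<subseteq> L" unfolding L_def using set_add_upper[OF J i(1)] .
  have iS: "ideal (L <+> Idl {y} <+> Idl {z}) R" using iL i by (intro add_ideals)
  note S1 = set_add_upper[OF iL i(2)] set_add_upper[OF add_ideals[OF iL i(2)] i(3)]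
  have "red_at I (L <+> Idl {y} <+> Idl {z}) p"
  proof (rule red_at_mono[OF I I _ iS insert.prems(3) subset_refl])
    show "ideal (J <+> Idl (insert y (insert z Y))) R" using J i(4) by (rule add_ideals)
    show "J <+> Idl (insert y (insert z Y)) \<subseteq> L <+> Idl {y} <+> Idl {z}"
    proof (intro set_add_subsetI iS genideal_minimal)
      show "J \<subseteq> L <+> Idl {y} <+> Idl {z}" using S1 L1 by blast
      show "insert y (insert z Y) \<subseteq> L <+> Idl {y} <+> Idl {z}"
        using S1 L1 genideal_self'[OF c(1)] genideal_self'[OF c(2)] genideal_self[OF c(3)] by blast
    qed
  qed
  moreover have "z \<in> m" using insert.prems by simp
  ultimately obtain a q where a: "a \<in> carrier R" "red_at I (L <+> Idl {y \<ominus> a \<otimes> z}) q"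
    using merge_generators[OF I J x red iL L1(1) insert.prems(2)] by metis
  let ?y = "y \<ominus> a \<otimes> z"
  have ym: "?y \<in> m" using insert.prems a(1) by (simp add: a_minus_def m.I_l_closed)
  have yc: "?y \<in> carrier R" using m_carrier[OF ym] .
  have iy: "ideal (Idl {?y}) R" "ideal (Idl (insert ?y Y)) R" using yc c by (auto intro!: ideal_Idl)
  have "red_at I (J <+> Idl (insert ?y Y)) q"
  proof (rule red_at_mono[OF I I _ _ a(2) subset_refl])
    show "ideal (L <+> Idl {?y}) R" "ideal (J <+> Idl (insert ?y Y)) R" using iL J iy by (auto intro: add_ideals)
    then show "L <+> Idl {?y} \<subseteq> J <+> Idl (insert ?y Y)"
      unfolding L_def
      using set_add_upper[OF J iy(2)] genideal_self[of "insert ?y Y"] yc c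
      by (intro set_add_subsetI genideal_minimal) auto
  qed
  from insert(3)[OF _ ym this] insert.prems obtain y' q' where
    y': "y' \<in> Idl (insert ?y Y)" "red_at I (J <+> Idl {y'}) q'" by auto
  have ss: "insert y (insert z Y) \<subseteq> Idl (insert y (insert z Y))" using c by (intro genideal_self) auto
  have "?y \<in> Idl (insert y (insert z Y))"
    using ss a(1) additive_subgroup.a_closed[OF ideal.axioms(1)[OF i(4)]]
      additive_subgroup.a_inv_closed[OF ideal.axioms(1)[OF i(4)]] ideal.I_l_closed[OF i(4)]
    by (simp add: a_minus_def)
  then have "Idl (insert ?y Y) \<subseteq> Idl (insert y (insert z Y))"
    using ss by (intro genideal_minimal i) auto
  with y' show ?case by blast
qed

section \<open>Reductions with the fewest generators\<close>

text \<open>The elements of \<open>X\<close> are exchanged one at a time for elements of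
  \<open>Q\<close>, which \<open>Z\<close> collects. Exchanged elements may coincide, so the
  cardinality is only bounded.\<close>

lemma reduction_contains_small_reduction:
  assumes I: "ideal I R" and Q: "ideal Q R" "Q \<subseteq> m" "red_at I Q p"
    and X: "finite X" "X \<subseteq> m" "red_at I (Idl X) r"
  shows "\<exists>Y q. finite Y \<and> Y \<subseteq> Q \<and> card Y \<le> card X \<and> red_at I (Idl Y) q"
proof -
  obtain G where G: "G \<subseteq> carrier R" "finite G" "Q = Idl G" using finetely_gen[OF Q(1)] by blast
  have GQ: "G \<subseteq> Q" unfolding G(3) by (rule genideal_self[OF G(1)])
  have zQ: "\<zero> \<in> Q" using Q(1) by (simp add: additive_subgroup.zero_closed ideal.axioms(1))
  have "\<exists>Y q. finite Y \<and> Y \<subseteq> Q \<and> card Y \<le> card Z + card X \<and> red_at I (Idl Y) q"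
    if "finite Z" "Z \<subseteq> Q" "red_at I (Idl (Z \<union> X)) r" for Z r
    using X(1,2) that
  proof (induct X arbitrary: Z r rule: finite_induct)
    case empty
    then show ?case by (intro exI[of _ Z] exI[of _ r]) auto
  next
    case (insert x X)
    have c: "x \<in> carrier R" "X \<subseteq> carrier R" "Z \<subseteq> carrier R" "Z \<union> X \<subseteq> carrier R"
      using insert.prems Q(2) m_carrier by auto
    define J where "J = Idl (Z \<union> X)"
    have iJ: "ideal J R" unfolding J_def using c by (intro ideal_Idl) auto
    have ix: "ideal (Idl {x}) R" using c by (intro ideal_Idl) auto
    have iJx: "ideal (J <+> Idl {x}) R" using iJ ix by (rule add_ideals)
    note u = set_add_upper[OF iJ ix]
    have J1: "Z \<union> X \<subseteq> J" unfolding J_def using c by (intro genideal_self) auto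
    have r1: "red_at I (J <+> Idl {x}) r"
    proof (rule red_at_mono[OF I I _ iJx insert.prems(4) subset_refl])
      show "ideal (Idl (Z \<union> insert x X)) R" using c by (intro ideal_Idl) auto
      show "Idl (Z \<union> insert x X) \<subseteq> J <+> Idl {x}"
        using J1 u genideal_self'[OF c(1)] by (intro genideal_minimal iJx) auto
    qed
    \<comment> \<open>\<open>exchange\<close> expects a distinguished first generator, and
      \<open>G\<close> may be empty; \<open>\<zero>\<close> serves as one.\<close>
    have r2: "red_at I (J <+> Idl (insert \<zero> G)) p"
    proof (rule red_at_mono[OF I I Q(1) _ Q(3) subset_refl])
      have i: "ideal (Idl (insert \<zero> G)) R" using G(1) by (intro ideal_Idl) auto
      show ii: "ideal (J <+> Idl (insert \<zero> G)) R" using iJ i by (rule add_ideals)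
      have "Idl G \<subseteq> Idl (insert \<zero> G)" using G(1) by (intro subset_Idl_subset) auto
      then show "Q \<subseteq> J <+> Idl (insert \<zero> G)" unfolding G(3) using set_add_upper[OF iJ i] by blast
    qed
    have "x \<in> m" "G \<subseteq> m" "\<zero> \<in> m" using insert.prems GQ Q(2) zQ by auto
    from exchange[OF I iJ this(1) r1 G(2) this(2,3) r2] obtain y q where
      y: "y \<in> Idl (insert \<zero> G)" "red_at I (J <+> Idl {y}) q" by blast
    have yQ: "y \<in> Q" using y(1) genideal_minimal[OF Q(1), of "insert \<zero> G"] GQ zQ by blast
    have yc: "y \<in> carrier R" using ideal.Icarr[OF Q(1) yQ] .
    have iy: "ideal (Idl {y}) R" "ideal (Idl (insert y Z \<union> X)) R" using yc c by (auto intro!: ideal_Idl)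
    have "red_at I (Idl (insert y Z \<union> X)) q"
    proof (rule red_at_mono[OF I I add_ideals[OF iJ iy(1)] iy(2) y(2) subset_refl])
      show "J <+> Idl {y} \<subseteq> Idl (insert y Z \<union> X)"
        unfolding J_def using yc c by (intro set_add_subsetI iy subset_Idl_subset) auto
    qed
    with insert(3)[of "insert y Z" q] insert.prems yQ obtain Y q' where
      Y: "finite Y" "Y \<subseteq> Q" "card Y \<le> card (insert y Z) + card X" "red_at I (Idl Y) q'" by auto
    have "card (insert y Z) \<le> Suc (card Z)" using insert.prems by (simp add: card_insert_if)
    then have "card Y \<le> card Z + card (insert x X)" using Y(3) insert(1,2) by simp
    with Y show ?case by blast
  qed
  from this[of "{}" r] X show ?thesis by simp
qed

text \<open>Classically this number is the Krull dimension of \<open>R Quot I\<close>.\<close>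

definition analytic_spread :: "'a set \<Rightarrow> nat" where
  "analytic_spread I = (LEAST k. \<exists>X r. finite X \<and> X \<subseteq> m \<and> card X = k \<and> red_at I (Idl X) r)"

lemma red_at_m: "ideal I R \<Longrightarrow> red_at I m 0"
  unfolding red_at_def using set_add_upper(1)[OF ideal_prod_is_ideal[OF m_ideal pw_ideal[of 0]]] by simp

lemma analytic_spread_attained:
  assumes "ideal I R"
  obtains X r where "finite X" "X \<subseteq> m" "card X = analytic_spread I" "red_at I (Idl X) r"
proof -
  obtain G where G: "G \<subseteq> carrier R" "finite G" "m = Idl G" using finetely_gen[OF m_ideal] by blast
  have "G \<subseteq> m" using genideal_self[OF G(1)] unfolding G(3)[symmetric] .
  then have "\<exists>k X r. finite X \<and> X \<subseteq> m \<and> card X = k \<and> red_at I (Idl X) r"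
    using G(2) red_at_m[OF assms] unfolding G(3)[symmetric] by (intro exI[of _ "card G"] exI[of _ G] exI[of _ 0]) (simp flip: G(3))
  from LeastI_ex[OF this] show thesis using that unfolding analytic_spread_def by blast
qed

lemma analytic_spread_le:
  assumes "finite X" "X \<subseteq> m" "red_at I (Idl X) r"
  shows "analytic_spread I \<le> card X"
  unfolding analytic_spread_def using assms by (intro Least_le) blast

text \<open>If \<open>Q\<close> spanned a proper subspace of \<open>Idl X\<close> modulo
  \<open>U\<close>, fewer than \<open>card X\<close> elements would span it. Because
  \<open>m \<cdot> (Idl X) \<subseteq> m \<cdot> m\<close>, they would still generate a reduction by
  \<open>red_at_drop\<close>, against the choice of \<open>analytic_spread I\<close>. So
  \<open>Q\<close> spans everything, and Nakayama removes \<open>m \<cdot> (Idl X)\<close>.\<close>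

lemma small_reduction_minimal:
  assumes I: "ideal I R" "I \<subseteq> m" and X: "finite X" "X \<subseteq> m" "card X \<le> analytic_spread I"
    and Q: "ideal Q R" "Q \<subseteq> Idl X <+> I" "red_at I Q q"
  shows "Idl X \<subseteq> Q <+> I"
proof -
  have Xc: "X \<subseteq> carrier R" using X(2) m_carrier by blast
  have iX: "ideal (Idl X) R" using Xc by (rule ideal_Idl)
  have Xm: "Idl X \<subseteq> m" using X(2) by (rule Idl_subset_m)
  define U where "U = m \<cdot> (Idl X) <+> I"
  have imX: "ideal (m \<cdot> (Idl X)) R" using m_ideal iX by (rule ideal_prod_is_ideal)
  have iU: "ideal U R" unfolding U_def using imX I(1) by (rule add_ideals)
  have U1: "m \<cdot> (Idl X) \<subseteq> U" "I \<subseteq> U" unfolding U_def using set_add_upper[OF imX I(1)] .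
  define D where "D = Q <+> U"
  have iD: "ideal D R" unfolding D_def using Q(1) iU by (rule add_ideals)
  have D1: "Q \<subseteq> D" "U \<subseteq> D" unfolding D_def using set_add_upper[OF Q(1) iU] .
  have XI: "Idl X \<subseteq> Idl X <+> U" "U \<subseteq> Idl X <+> U" using set_add_upper[OF iX iU] .
  have iXU: "ideal (Idl X <+> U) R" using iX iU by (rule add_ideals)
  have "Idl X <+> I \<subseteq> Idl X <+> U" using XI U1 by (intro set_add_subsetI iXU) auto
  then have DX: "D \<subseteq> Idl X <+> U" unfolding D_def using Q(2) XI by (intro set_add_subsetI iXU) auto
  obtain V where V: "finite V" "V \<subseteq> carrier R" "D = Idl V <+> U"
    "D \<noteq> Idl X <+> U \<longrightarrow> card V < card X"
    using subspace_generators[OF X(1) Xc iU U1(1) iD D1(2) DX] by blast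
  have iV: "ideal (Idl V) R" using V(2) by (rule ideal_Idl)
  have Um: "U \<subseteq> m" unfolding U_def using I(2) ideal_prod_inter[OF m_ideal iX] by (intro set_add_subsetI m_ideal) auto
  have "D = Idl X <+> U"
  proof (rule ccontr)
    assume "D \<noteq> Idl X <+> U"
    with V(4) have "card V < card X" by blast
    moreover have "V \<subseteq> m"
    proof -
      have "V \<subseteq> D" using genideal_self[OF V(2)] set_add_upper(1)[OF iV iU] unfolding V(3) by blast
      also have "\<dots> \<subseteq> Idl X <+> U" by (rule DX)
      also have "\<dots> \<subseteq> m" using Xm Um by (rule set_add_subsetI[OF m_ideal])
      finally show ?thesis .
    qed
    moreover have "red_at I (Idl V) q"
    proof (rule red_at_drop[OF I(1) Q(1) iV Q(3)])
      have ii: "ideal (Idl V <+> m \<cdot> m) R" using iV m_ideal by (intro add_ideals ideal_prod_is_ideal)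
      have iii: "ideal (Idl V <+> m \<cdot> m <+> I) R" using ii I(1) by (rule add_ideals)
      note u = set_add_upper[OF iV ideal_prod_is_ideal[OF m_ideal m_ideal]] set_add_upper[OF ii I(1)]
      have "m \<cdot> (Idl X) \<subseteq> m \<cdot> m" using Xm by (intro ideal_prod_mono m_ideal) auto
      then have "U \<subseteq> Idl V <+> m \<cdot> m <+> I" unfolding U_def using u by (intro set_add_subsetI iii) auto
      then have "D \<subseteq> Idl V <+> m \<cdot> m <+> I" unfolding V(3) using u by (intro set_add_subsetI iii) auto
      then show "Q \<subseteq> Idl V <+> m \<cdot> m <+> I" using D1 by blast
    qed
    ultimately show False using analytic_spread_le[OF V(1)] X(3) by fastforce
  qed
  then have XD: "Idl X \<subseteq> Q <+> U" using XI(1) unfolding D_def by blast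
  have iQI: "ideal (Q <+> I) R" using Q(1) I(1) by (rule add_ideals)
  have iQX: "ideal (Q <+> I <+> m \<cdot> (Idl X)) R" using iQI imX by (rule add_ideals)
  note u = set_add_upper[OF Q(1) I(1)] set_add_upper[OF iQI imX]
  have "U \<subseteq> Q <+> I <+> m \<cdot> (Idl X)" unfolding U_def using u by (intro set_add_subsetI iQX) auto
  then have "Q <+> U \<subseteq> Q <+> I <+> m \<cdot> (Idl X)" using u by (intro set_add_subsetI iQX) auto
  with XD have "Idl X \<subseteq> Q <+> I <+> m \<cdot> (Idl X)" by blast
  then show ?thesis by (rule nakayama[OF iX iQI])
qed

section \<open>Reductions common to two quotients\<close>

text \<open>Write \<open>u\<close> in \<open>pw (Suc r)\<close> as a sum of terms
  \<open>f x \<otimes> c\<close> plus an element of \<open>I\<close>, and let \<open>B u\<close> be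
  the same sum with \<open>g x\<close> for \<open>f x\<close>. Then
  \<open>B u \<ominus> t \<otimes> u\<close> lies in \<open>K t\<close> for all \<open>t\<close> at
  once, so the iterates of \<open>B\<close> on a generator are geometric modulo the pencil. For
  almost all \<open>t\<close> every generator falls into
  \<open>K t <+> m \<cdot> pw (Suc r)\<close>, and Nakayama drops the second summand.\<close>

lemma pencil_reduction_finite:
  assumes I: "ideal I R" and fg: "f ` X \<subseteq> m" "g ` X \<subseteq> m" and red: "red_at I (Idl (f ` X)) r"
    and T: "T \<subseteq> carrier R" "\<And>s t. s \<in> T \<Longrightarrow> t \<in> T \<Longrightarrow> s \<noteq> t \<Longrightarrow> s \<ominus> t \<notin> m"
  shows "finite {t \<in> T. \<not> red_at I (Idl ((\<lambda>x. g x \<ominus> t \<otimes> f x) ` X)) r}"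
proof -
  define Z where "Z t = Idl ((\<lambda>x. g x \<ominus> t \<otimes> f x) ` X)" for t
  define M where "M = pw (Suc r)"
  have iM: "ideal M R" unfolding M_def by (rule pw_ideal)
  interpret M: ideal M R by (rule iM)
  have fc: "f x \<in> m" "g x \<in> m" "f x \<in> carrier R" "g x \<in> carrier R" if "x \<in> X" for x
    using fg that m_carrier by auto
  have zc: "(\<lambda>x. g x \<ominus> t \<otimes> f x) ` X \<subseteq> carrier R" if "t \<in> carrier R" for t
    using fc that by auto
  have iZ: "ideal (Z t) R" if "t \<in> carrier R" for t unfolding Z_def using zc[OF that] by (rule ideal_Idl)
  define K where "K t = Z t \<cdot> pw r <+> I" for t
  have iK: "ideal (K t) R" if "t \<in> carrier R" for t
    unfolding K_def using iZ[OF that] I by (intro ideal_intros)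
  have K1: "Z t \<cdot> pw r \<subseteq> K t" "I \<subseteq> K t" if "t \<in> carrier R" for t
    unfolding K_def using set_add_upper[OF ideal_prod_is_ideal[OF iZ[OF that] pw_ideal] I] .
  \<comment> \<open>\<open>A\<close> collects the \<open>u\<close> that admit a value
    \<open>B u\<close>. Showing that it is an ideal avoids choosing coefficients; \<open>B\<close>
    is then any choice function, linear or not.\<close>
  define A where "A = {u \<in> carrier R. \<exists>v\<in>M. \<forall>t\<in>carrier R. v \<ominus> t \<otimes> u \<in> K t}"
  have iA: "ideal A R"
  proof (rule idealI[OF ring_axioms])
    show 1: "x \<otimes> u \<in> A" if u: "u \<in> A" and x: "x \<in> carrier R" for u x
    proof -
      obtain v where v: "v \<in> M" "\<And>t. t \<in> carrier R \<Longrightarrow> v \<ominus> t \<otimes> u \<in> K t" "u \<in> carrier R"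
        using u by (auto simp: A_def)
      have "x \<otimes> v \<ominus> t \<otimes> (x \<otimes> u) \<in> K t" if t: "t \<in> carrier R" for t
      proof -
        have "x \<otimes> v \<ominus> t \<otimes> (x \<otimes> u) = x \<otimes> (v \<ominus> t \<otimes> u)" using v(3) M.Icarr[OF v(1)] x t by algebra
        then show ?thesis using ideal.I_l_closed[OF iK[OF t] v(2)[OF t] x] by simp
      qed
      then show ?thesis using v x unfolding A_def by (auto intro!: bexI[of _ "x \<otimes> v"] M.I_l_closed)
    qed
    show "u \<otimes> x \<in> A" if "u \<in> A" "x \<in> carrier R" for u x
      using 1[OF that] that by (simp add: A_def m_comm)
    show "subgroup A (add_monoid R)"
    proof (rule subgroup.intro)
      show "A \<subseteq> carrier (add_monoid R)" by (auto simp: A_def)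
      show "\<one>\<^bsub>add_monoid R\<^esub> \<in> A"
        using iK by (auto simp: A_def a_minus_def additive_subgroup.zero_closed ideal.axioms(1) intro!: bexI[of _ \<zero>])
      show "u \<otimes>\<^bsub>add_monoid R\<^esub> u' \<in> A" if u: "u \<in> A" "u' \<in> A" for u u'
      proof -
        obtain v where v: "v \<in> M" "\<And>t. t \<in> carrier R \<Longrightarrow> v \<ominus> t \<otimes> u \<in> K t" "u \<in> carrier R"
          using u by (auto simp: A_def)
        obtain v' where v': "v' \<in> M" "\<And>t. t \<in> carrier R \<Longrightarrow> v' \<ominus> t \<otimes> u' \<in> K t" "u' \<in> carrier R"
          using u by (auto simp: A_def)
        have "(v \<oplus> v') \<ominus> t \<otimes> (u \<oplus> u') \<in> K t" if t: "t \<in> carrier R" for t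
        proof -
          have "(v \<oplus> v') \<ominus> t \<otimes> (u \<oplus> u') = (v \<ominus> t \<otimes> u) \<oplus> (v' \<ominus> t \<otimes> u')"
            using v(3) v'(3) M.Icarr[OF v(1)] M.Icarr[OF v'(1)] t by algebra
          then show ?thesis
            using additive_subgroup.a_closed[OF ideal.axioms(1)[OF iK[OF t]] v(2)[OF t] v'(2)[OF t]] by simp
        qed
        then show ?thesis using v(1,3) v'(1,3) M.a_closed unfolding A_def by auto
      qed
      show "inv\<^bsub>add_monoid R\<^esub> u \<in> A" if u: "u \<in> A" for u
      proof -
        have "u \<in> carrier R" using u by (simp add: A_def)
        then have "inv\<^bsub>add_monoid R\<^esub> u = (\<ominus> \<one>) \<otimes> u" by (simp add: l_minus flip: a_inv_def)
        then show ?thesis using 1[OF u, of "\<ominus> \<one>"] by simp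
      qed
    qed
  qed
  have "(Idl (f ` X)) \<cdot> pw r \<subseteq> A"
  proof (rule Idl_prod_subsetI[OF _ pw_ideal iA])
    show "f ` X \<subseteq> carrier R" using fc by auto
    fix s c assume s: "s \<in> f ` X" and c: "c \<in> pw r"
    obtain x where x: "x \<in> X" "s = f x" using s by blast
    have cc: "c \<in> carrier R" using c by (rule pw_carrier)
    have "g x \<otimes> c \<in> M" unfolding M_def using fc[OF x(1)] c by (auto intro: ideal_prod.prod)
    moreover have "g x \<otimes> c \<ominus> t \<otimes> (f x \<otimes> c) \<in> K t" if t: "t \<in> carrier R" for t
    proof -
      have "g x \<otimes> c \<ominus> t \<otimes> (f x \<otimes> c) = (g x \<ominus> t \<otimes> f x) \<otimes> c" using fc(3,4)[OF x(1)] cc t by algebra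
      moreover have "g x \<ominus> t \<otimes> f x \<in> Z t" unfolding Z_def using genideal_self[OF zc[OF t]] x by blast
      ultimately show ?thesis using ideal_prod.prod[OF _ c, of _ "Z t" R] K1(1)[OF t] by auto
    qed
    ultimately show "s \<otimes> c \<in> A" unfolding A_def x(2) using fc[OF x(1)] cc by blast
  qed
  moreover have "I \<subseteq> A"
  proof
    fix i assume i: "i \<in> I"
    have ic: "i \<in> carrier R" using ideal.Icarr[OF I i] .
    have "\<zero> \<ominus> t \<otimes> i \<in> K t" if t: "t \<in> carrier R" for t
    proof -
      have "\<zero> \<ominus> t \<otimes> i = (\<ominus> t) \<otimes> i" using ic t by algebra
      then show ?thesis using ideal.I_l_closed[OF I i, of "\<ominus> t"] K1(2)[OF t] t by auto
    qed
    then show "i \<in> A" unfolding A_def using ic M.zero_closed by blast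
  qed
  ultimately have "(Idl (f ` X)) \<cdot> pw r <+> I \<subseteq> A" by (rule set_add_subsetI[OF iA])
  then have "M \<subseteq> A" using red unfolding red_at_def M_def by blast
  then have "\<forall>u\<in>M. \<exists>v. v \<in> M \<and> (\<forall>t\<in>carrier R. v \<ominus> t \<otimes> u \<in> K t)" by (auto simp: A_def)
  then obtain B where B: "\<And>u. u \<in> M \<Longrightarrow> B u \<in> M" "\<And>u t. u \<in> M \<Longrightarrow> t \<in> carrier R \<Longrightarrow> B u \<ominus> t \<otimes> u \<in> K t"
    by (metis bchoice)
  obtain G where G: "G \<subseteq> carrier R" "finite G" "M = Idl G" using finetely_gen[OF iM] by blast
  define U where "U = m \<cdot> M"
  have iU: "ideal U R" unfolding U_def using m_ideal iM by (rule ideal_prod_is_ideal)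
  define L where "L t = K t <+> U" for t
  have iL: "ideal (L t) R" if "t \<in> carrier R" for t unfolding L_def using iK[OF that] iU by (rule add_ideals)
  have L1: "K t \<subseteq> L t" "U \<subseteq> L t" if "t \<in> carrier R" for t
    unfolding L_def using set_add_upper[OF iK[OF that] iU] .
  have "finite {t \<in> T. e \<notin> L t}" if e: "e \<in> M" for e
  proof -
    have Be: "(B ^^ i) e \<in> M" for i using e B(1) by (induct i) auto
    have "finite {t \<in> T. (B ^^ 0) e \<notin> L t}"
    proof (rule geometric_mod_pencil_finite[where n = "card G" and G = G and U = U])
      show "m \<cdot> (Idl G) \<subseteq> U" unfolding U_def G(3) by blast
      show "(B ^^ i) e \<in> Idl G <+> U" for i
        using Be set_add_upper(1)[OF iM iU] unfolding G(3)[symmetric] by blast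
      show "(B ^^ Suc i) e \<ominus> t \<otimes> (B ^^ i) e \<in> L t" if "t \<in> T" for t i
        using B(2)[OF Be, of t i] L1(1) T(1) that by auto
      show "U \<subseteq> L t" if "t \<in> T" for t using that T(1) L1(2) by blast
    qed (use G iU T iL in auto)
    then show ?thesis by simp
  qed
  moreover have "G \<subseteq> M" unfolding G(3) by (rule genideal_self[OF G(1)])
  ultimately have fin: "finite (\<Union>e\<in>G. {t \<in> T. e \<notin> L t})" using G(2) by blast
  have "red_at I (Z t) r" if t: "t \<in> T" "t \<notin> (\<Union>e\<in>G. {t \<in> T. e \<notin> L t})" for t
  proof -
    have tc: "t \<in> carrier R" using t T by blast
    have "G \<subseteq> L t" using t by blast
    then have "M \<subseteq> L t" unfolding G(3) by (rule genideal_minimal[OF iL[OF tc]])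
    then have "M \<subseteq> K t" unfolding L_def U_def by (rule nakayama[OF iM iK[OF tc]])
    then show ?thesis by (simp only: red_at_def M_def K_def)
  qed
  then have "{t \<in> T. \<not> red_at I (Z t) r} \<subseteq> (\<Union>e\<in>G. {t \<in> T. e \<notin> L t})" by blast
  with fin show ?thesis unfolding Z_def by (rule finite_subset[rotated])
qed

text \<open>A pencil inherits the exponent of the family multiplied by \<open>t\<close>, so
  \<open>x \<ominus> t \<otimes> g x\<close> serves \<open>J\<close> for almost all
  \<open>t\<close>. With the roles exchanged, \<open>g x \<ominus> t' \<otimes> x\<close> serves
  \<open>I\<close> for almost all \<open>t'\<close>, and for \<open>t'\<close> inverse to
  \<open>t\<close> it is a unit multiple of the former. Hence the parameters must be units with
  pairwise incongruent inverses.\<close>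

lemma common_reduction:
  assumes I: "ideal I R" and J: "ideal J R" and X: "finite X" "X \<subseteq> m" "red_at I (Idl X) r"
    and Y: "finite Y" "Y \<subseteq> m" "red_at J (Idl Y) s" and card: "card X = card Y"
  obtains Z where "finite Z" "Z \<subseteq> m" "card Z \<le> card X" "red_at I (Idl Z) r" "red_at J (Idl Z) s"
proof -
  obtain g where g: "bij_betw g X Y" using finite_same_card_bij[OF X(1) Y(1) card] by blast
  have gX: "g ` X = Y" using g by (simp add: bij_betw_def)
  have c: "x \<in> m" "g x \<in> m" "x \<in> carrier R" "g x \<in> carrier R" if "x \<in> X" for x
    using that X(2) Y(2) gX m_carrier by auto
  obtain T where T: "T \<subseteq> carrier R" "infinite T" "\<And>s t. s \<in> T \<Longrightarrow> t \<in> T \<Longrightarrow> s \<noteq> t \<Longrightarrow> s \<ominus> t \<notin> m"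
    using residue_representatives by metis
  \<comment> \<open>Two parameters in \<open>m\<close> would be congruent, so discarding the
    nonunits costs at most one.\<close>
  have "is_singleton (T \<inter> m) \<or> T \<inter> m = {}"
  proof -
    have "s = t" if "s \<in> T \<inter> m" "t \<in> T \<inter> m" for s t
      using T(3)[of s t] that by (auto simp: a_minus_def)
    then show ?thesis using is_singletonI'[of "T \<inter> m"] by blast
  qed
  then have "finite (T \<inter> m)" by (auto simp: is_singleton_def)
  define T0 where "T0 = T - T \<inter> m"
  have T0: "infinite T0" unfolding T0_def using \<open>finite (T \<inter> m)\<close> T(2) by (rule Diff_infinite_finite)
  have T0c: "t \<in> T" "t \<in> carrier R" "t \<notin> m" if "t \<in> T0" for t using that T(1) by (auto simp: T0_def)
  have "\<forall>t\<in>T0. \<exists>b. b \<in> carrier R \<and> b \<otimes> t = \<one>" using unit_of_not_in_m T0c by metis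
  then obtain h where h: "\<And>t. t \<in> T0 \<Longrightarrow> h t \<in> carrier R" "\<And>t. t \<in> T0 \<Longrightarrow> h t \<otimes> t = \<one>"
    by (metis bchoice)
  have diff: "h s \<ominus> h t \<notin> m" if st: "s \<in> T0" "t \<in> T0" "s \<noteq> t" for s t
  proof
    assume a: "h s \<ominus> h t \<in> m"
    have cs: "s \<in> carrier R" "t \<in> carrier R" "h s \<in> carrier R" "h t \<in> carrier R" using st T0c h by auto
    have "(s \<otimes> t) \<otimes> (h s \<ominus> h t) \<in> m" using a cs by (intro m.I_l_closed) auto
    moreover have "(s \<otimes> t) \<otimes> (h s \<ominus> h t) = (h s \<otimes> s) \<otimes> t \<ominus> (h t \<otimes> t) \<otimes> s" using cs by algebra
    ultimately have "t \<ominus> s \<in> m" using h st cs by simp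
    then show False using T(3)[of t s] st T0c by auto
  qed
  have diff': "u \<ominus> v \<notin> m" if uv: "u \<in> h ` T0" "v \<in> h ` T0" "u \<noteq> v" for u v
  proof -
    obtain s t where "s \<in> T0" "t \<in> T0" "u = h s" "v = h t" using uv(1,2) by blast
    with uv(3) show ?thesis using diff[of s t] by blast
  qed
  have hinj: "inj_on h T0"
  proof (rule inj_onI, rule ccontr)
    fix s t assume "s \<in> T0" "t \<in> T0" "h s = h t" "s \<noteq> t"
    then show False using diff[of s t] h(1)[of t] by (simp add: a_minus_def r_neg)
  qed
  define B1 where "B1 = {t \<in> T0. \<not> red_at J (Idl ((\<lambda>x. x \<ominus> t \<otimes> g x) ` X)) s}"
  define B2 where "B2 = {t \<in> h ` T0. \<not> red_at I (Idl ((\<lambda>x. g x \<ominus> t \<otimes> x) ` X)) r}"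
  have "finite B1" unfolding B1_def
    by (rule pencil_reduction_finite[OF J, where g = "\<lambda>x. x" and f = g])
      (use X Y gX T0c T(3) in auto)
  moreover have "finite B2" unfolding B2_def
    by (rule pencil_reduction_finite[OF I, where g = g and f = "\<lambda>x. x"])
      (use X Y gX h(1) diff' in auto)
  then have "finite (h -` B2 \<inter> T0)" using hinj by (rule finite_vimage_IntI)
  ultimately have "infinite (T0 - (B1 \<union> (h -` B2 \<inter> T0)))" using T0 by (simp add: Diff_infinite_finite)
  then obtain t where t: "t \<in> T0" "t \<notin> B1" "h t \<notin> B2" using infinite_imp_nonempty by blast
  have tc: "t \<in> carrier R" "h t \<in> carrier R" using T0c h t by auto
  define Z where "Z = (\<lambda>x. x \<ominus> t \<otimes> g x) ` X"
  have Zm: "Z \<subseteq> m" unfolding Z_def using c tc by (auto simp: a_minus_def m.I_l_closed)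
  have Zc: "Z \<subseteq> carrier R" using Zm m_carrier by blast
  let ?W = "(\<lambda>x. g x \<ominus> h t \<otimes> x) ` X"
  have Wc: "?W \<subseteq> carrier R" using c tc by auto
  have "?W \<subseteq> Idl Z"
  proof clarify
    fix x assume x: "x \<in> X"
    have "g x \<ominus> h t \<otimes> x = (\<ominus> h t) \<otimes> (x \<ominus> t \<otimes> g x)"
    proof -
      have "(\<ominus> h t) \<otimes> (x \<ominus> t \<otimes> g x) = (h t \<otimes> t) \<otimes> g x \<ominus> h t \<otimes> x" using c[OF x] tc by algebra
      then show ?thesis using h(2)[OF t(1)] c[OF x] by simp
    qed
    moreover have "x \<ominus> t \<otimes> g x \<in> Idl Z" using genideal_self[OF Zc] x by (auto simp: Z_def)
    ultimately show "g x \<ominus> h t \<otimes> x \<in> Idl Z"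
      using ideal.I_l_closed[OF ideal_Idl[OF Zc], of _ "\<ominus> h t"] tc by simp
  qed
  then have "Idl ?W \<subseteq> Idl Z" by (rule genideal_minimal[OF ideal_Idl[OF Zc]])
  moreover have "red_at I (Idl ?W) r" using t by (auto simp: B2_def)
  ultimately have "red_at I (Idl Z) r"
    using red_at_mono[OF I I ideal_Idl[OF Wc] ideal_Idl[OF Zc]] by blast
  moreover have "red_at J (Idl Z) s" using t by (auto simp: B1_def Z_def)
  moreover have "finite Z" "card Z \<le> card X" unfolding Z_def using X(1) by (auto intro: card_image_le)
  ultimately show thesis using that Zm by blast
qed

end

section \<open>Passage to quotient rings\<close>

lemma (in ring_hom_ring) image_ideal_prod:
  assumes "J \<subseteq> carrier R" "K \<subseteq> carrier R"
  shows "h ` (ideal_prod R J K) = ideal_prod S (h ` J) (h ` K)"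
proof -
  have c: "z \<in> carrier R" if "z \<in> ideal_prod R J K" for z
    using that by induct (use assms in auto)
  show ?thesis
  proof (intro equalityI subsetI)
    fix y assume "y \<in> h ` (ideal_prod R J K)"
    then obtain z where "z \<in> ideal_prod R J K" "y = h z" by blast
    moreover have "h z \<in> ideal_prod S (h ` J) (h ` K)" if "z \<in> ideal_prod R J K" for z
      using that
    proof induct
      case (prod i j)
      then have "h (i \<otimes>\<^bsub>R\<^esub> j) = h i \<otimes>\<^bsub>S\<^esub> h j" using assms by (intro hom_mult) auto
      with prod show ?case by (auto intro: ideal_prod.prod)
    next
      case (sum s1 s2)
      then show ?case using c by (simp add: ideal_prod.sum)
    qed
    ultimately show "y \<in> ideal_prod S (h ` J) (h ` K)" by simp
  next
    fix y assume "y \<in> ideal_prod S (h ` J) (h ` K)"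
    then show "y \<in> h ` (ideal_prod R J K)"
    proof induct
      case (prod i j)
      then obtain a b where ab: "a \<in> J" "b \<in> K" "i = h a" "j = h b" by blast
      then have "i \<otimes>\<^bsub>S\<^esub> j = h (a \<otimes>\<^bsub>R\<^esub> b)" using assms by (simp add: subset_iff)
      then show ?case using ab by (auto intro: ideal_prod.prod)
    next
      case (sum s1 s2)
      then obtain a b where ab: "a \<in> ideal_prod R J K" "b \<in> ideal_prod R J K" "s1 = h a" "s2 = h b" by blast
      then have "s1 \<oplus>\<^bsub>S\<^esub> s2 = h (a \<oplus>\<^bsub>R\<^esub> b)" using c by simp
      then show ?case using ab by (auto intro: ideal_prod.sum)
    qed
  qed
qed

context noetherian_local_ring_inf
begin

context
  fixes I :: "'a set"
  assumes I: "ideal I R" and I_proper: "I \<noteq> carrier R"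
begin

abbreviation proj :: "'a \<Rightarrow> 'a set" where "proj \<equiv> (+>) I"

lemma I_subset_m: "I \<subseteq> m"
  using I I_proper by (rule proper_ideal_subset_m)

lemma proj_hom: "ring_hom_ring R (R Quot I) proj"
  using ideal.rcos_ring_hom_ring[OF I] .

lemma carrier_quot: "carrier (R Quot I) = proj ` carrier R"
  by (auto simp: FactRing_def A_RCOSETS_def')

lemma proj_mem_iff:
  assumes "ideal Q R" "a \<in> carrier R"
  shows "proj a \<in> proj ` Q \<longleftrightarrow> a \<in> Q <+> I"
proof
  assume "proj a \<in> proj ` Q"
  then obtain b where b: "b \<in> Q" "proj a = proj b" by blast
  have bc: "b \<in> carrier R" using ideal.Icarr[OF assms(1) b(1)] .
  have "a \<ominus> b \<in> I" using quotient_eq_iff_same_a_r_cos[OF I assms(2) bc] b(2) by blast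
  from set_addI[OF b(1) this] have "b \<oplus> (a \<ominus> b) \<in> Q <+> I" .
  moreover have "b \<oplus> (a \<ominus> b) = a" using bc assms(2) by algebra
  ultimately show "a \<in> Q <+> I" by simp
next
  assume "a \<in> Q <+> I"
  then obtain b i where b: "b \<in> Q" "i \<in> I" "a = b \<oplus> i" by (rule set_addE)
  have c: "b \<in> carrier R" "i \<in> carrier R" using ideal.Icarr[OF assms(1) b(1)] ideal.Icarr[OF I b(2)] .
  have "a \<ominus> b = i" unfolding b(3) using c by algebra
  then have "proj a = proj b" using quotient_eq_iff_same_a_r_cos[OF I assms(2) c(1)] b(2) by blast
  then show "proj a \<in> proj ` Q" using b(1) by simp
qed

lemma proj_image_subset_iff:
  assumes "ideal P R" "ideal Q R"
  shows "proj ` P \<subseteq> proj ` Q \<longleftrightarrow> P \<subseteq> Q <+> I"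
  using proj_mem_iff[OF assms(2)] ideal.Icarr[OF assms(1)] by blast

lemma quot_idealE:
  assumes "ideal q (R Quot I)"
  obtains Q where "ideal Q R" "q = proj ` Q" "I \<subseteq> Q"
proof -
  have "q \<in> (\<lambda>J. proj ` J) ` {J. ideal J R \<and> I \<subseteq> J}"
    using bij_betw_imp_surj_on[OF quot_ideal_correspondence[OF I]] assms by blast
  then show thesis using that by blast
qed

lemma proj_ideal: "ideal Q R \<Longrightarrow> ideal (proj ` Q) (R Quot I)"
  using ring_ideal_imp_quot_ideal[OF I] .

lemma set_add_I_absorb:
  assumes "ideal Q R" "I \<subseteq> Q"
  shows "Q <+> I = Q"
  using set_add_upper(1)[OF assms(1) I] set_add_subsetI[OF assms(1) subset_refl assms(2)] by blast

lemma proj_eq_carrier_iff: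
  assumes "ideal Q R"
  shows "proj ` Q = carrier (R Quot I) \<longleftrightarrow> Q <+> I = carrier R"
proof -
  have "proj ` Q \<subseteq> carrier (R Quot I)" unfolding carrier_quot using ideal.Icarr[OF assms] by blast
  moreover have "Q <+> I \<subseteq> carrier R" using ideal.Icarr[OF add_ideals[OF assms I]] by blast
  ultimately show ?thesis
    using proj_image_subset_iff[OF oneideal assms] unfolding carrier_quot by blast
qed

lemma maximalideal_quot_iff: "maximalideal M (R Quot I) \<longleftrightarrow> M = proj ` m"
proof
  have mI: "m <+> I = m" by (rule set_add_I_absorb[OF m_ideal I_subset_m])
  have proper: "proj ` m \<noteq> carrier (R Quot I)"
    using proj_eq_carrier_iff[OF m_ideal] mI m.I_notcarr by auto
  show "M = proj ` m" if M: "maximalideal M (R Quot I)"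
  proof -
    interpret M: maximalideal M "R Quot I" by (rule M)
    obtain Q where Q: "ideal Q R" "M = proj ` Q" "I \<subseteq> Q" using quot_idealE[OF M.is_ideal] .
    have "Q \<noteq> carrier R" using M.I_notcarr Q(2) carrier_quot by auto
    then have "M \<subseteq> proj ` m" unfolding Q(2) using proper_ideal_subset_m[OF Q(1)] by blast
    then show ?thesis
      using M.I_maximal[OF proj_ideal[OF m_ideal]] proper carrier_quot m_carrier by blast
  qed
  show "maximalideal M (R Quot I)" if M: "M = proj ` m"
    unfolding M
  proof (rule maximalidealI)
    show "ideal (proj ` m) (R Quot I)" by (rule proj_ideal[OF m_ideal])
    show "carrier (R Quot I) \<noteq> proj ` m" using proper by blast
    fix J assume J: "ideal J (R Quot I)" "proj ` m \<subseteq> J"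
    obtain Q where Q: "ideal Q R" "J = proj ` Q" "I \<subseteq> Q" using quot_idealE[OF J(1)] .
    have "m \<subseteq> Q" using J(2) unfolding Q(2) proj_image_subset_iff[OF m_ideal Q(1)] set_add_I_absorb[OF Q(1,3)] .
    then have "Q = m \<or> Q = carrier R" using m.I_maximal[OF Q(1)] ideal.Icarr[OF Q(1)] by blast
    then show "J = proj ` m \<or> J = carrier (R Quot I)" using Q(2) carrier_quot by blast
  qed
qed

lemma max_ideal_quot: "max_ideal (R Quot I) = proj ` m"
  unfolding max_ideal_def maximalideal_quot_iff by simp

lemma ideal_pow_quot: "ideal_pow (R Quot I) (proj ` m) k = proj ` pw k"
proof (induct k)
  case (Suc k)
  have "pw k \<subseteq> carrier R" using pw_carrier by blast
  then show ?case
    using ring_hom_ring.image_ideal_prod[OF proj_hom m.a_subset, of "pw k"] Suc by simp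
qed (simp add: carrier_quot)

lemma reduction_eq_iff_red_at:
  assumes Q: "ideal Q R" "Q \<subseteq> m"
  shows "ideal_pow (R Quot I) (proj ` m) (Suc r) = ideal_prod (R Quot I) (proj ` Q) (ideal_pow (R Quot I) (proj ` m) r)
    \<longleftrightarrow> red_at I Q r"
proof -
  have e: "ideal_prod (R Quot I) (proj ` Q) (proj ` pw r) = proj ` (Q \<cdot> pw r)"
    using ring_hom_ring.image_ideal_prod[OF proj_hom, of Q "pw r"] ideal.Icarr[OF Q(1)] pw_carrier by blast
  have "Q \<cdot> pw r \<subseteq> pw (Suc r)" using ideal_prod_mono[OF m_ideal pw_ideal Q(2) subset_refl] by simp
  then have "proj ` (Q \<cdot> pw r) \<subseteq> proj ` pw (Suc r)" by blast
  then show ?thesis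
    unfolding ideal_pow_quot e red_at_def
    using proj_image_subset_iff[OF pw_ideal ideal_prod_is_ideal[OF Q(1) pw_ideal], of "Suc r" r]
    by blast
qed

lemma proj_nat_pow:
  assumes "a \<in> carrier R"
  shows "proj a [^]\<^bsub>R Quot I\<^esub> (k::nat) = proj (a [^] k)"
  using ring_hom_cring.hom_pow[OF ideal.rcos_ring_hom_cring[OF I is_cring] assms] by simp

text \<open>\<open>P = Q <+> I\<close> is the full preimage. For \<open>a\<close> in
  \<open>m\<close> the power \<open>a [^] Suc r\<close> lies in \<open>pw (Suc r)\<close> and so in
  \<open>P\<close>, which gives the radical. If \<open>a \<otimes> b \<in> P\<close> with
  \<open>b\<close> outside \<open>m\<close>, then \<open>b\<close> is a unit and
  \<open>a \<in> P\<close>.\<close>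

lemma primary_quot:
  assumes Q: "ideal Q R" "Q \<subseteq> m" "red_at I Q r"
  shows "primary_to (R Quot I) (proj ` m) (proj ` Q)"
proof -
  let ?A = "R Quot I"
  define P where "P = Q <+> I"
  have iP: "ideal P R" unfolding P_def using Q(1) I by (rule add_ideals)
  have Pm: "P \<subseteq> m" unfolding P_def using Q(2) I_subset_m by (rule set_add_subsetI[OF m_ideal])
  have mem: "proj a \<in> proj ` Q \<longleftrightarrow> a \<in> P" if "a \<in> carrier R" for a
    using proj_mem_iff[OF Q(1) that] by (simp only: P_def)
  have memm: "proj a \<in> proj ` m \<longleftrightarrow> a \<in> m" if "a \<in> carrier R" for a
    using proj_mem_iff[OF m_ideal that] set_add_I_absorb[OF m_ideal I_subset_m] by simp
  have prime: "primeideal m R" using m.is_maximalideal by (rule maximalideal_prime)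
  have pow: "a \<in> m" if "a \<in> carrier R" "a [^] (k::nat) \<in> P" for a k
    using that(2)
  proof (induct k)
    case 0
    then show ?case using Pm m.one_imp_carrier m.I_notcarr by auto
  next
    case (Suc k)
    have "a [^] k \<otimes> a \<in> m" using Suc.prems Pm by auto
    then have "a [^] k \<in> m \<or> a \<in> m" using primeideal.I_prime[OF prime] that(1) by blast
    moreover have "a \<in> m" if "a [^] k \<in> m" for k :: nat
      using that
    proof (induct k)
      case 0
      then show ?case using m.one_imp_carrier m.I_notcarr by auto
    next
      case (Suc k)
      then show ?case using primeideal.I_prime[OF prime, of "a [^] k" a] \<open>a \<in> carrier R\<close> by auto
    qed
    ultimately show ?case by blast
  qed
  have pow': "a [^] Suc r \<in> P" if "a \<in> m" for a
  proof -
    have "a [^] Suc r \<in> pw (Suc r)" using that by (rule nat_pow_mem_ideal_pow[OF m_ideal])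
    also have "\<dots> \<subseteq> Q \<cdot> pw r <+> I" using Q(3) by (simp only: red_at_def)
    also have "\<dots> \<subseteq> P" unfolding P_def
      using ideal_prod_inter[OF Q(1) pw_ideal] by (intro set_add_mono Q(1) I) auto
    finally show ?thesis .
  qed
  have rad: "radical ?A (proj ` Q) = proj ` m"
  proof (intro equalityI subsetI)
    fix x assume "x \<in> radical ?A (proj ` Q)"
    then obtain a k where a: "a \<in> carrier R" "x = proj a" "proj a [^]\<^bsub>?A\<^esub> (k::nat) \<in> proj ` Q"
      unfolding radical_def carrier_quot by blast
    then have "a [^] k \<in> P" using mem[of "a [^] k"] by (simp add: proj_nat_pow)
    then show "x \<in> proj ` m" using pow[OF a(1)] a(2) by blast
  next
    fix x assume "x \<in> proj ` m"
    then obtain a where a: "a \<in> m" "x = proj a" by blast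
    have ac: "a \<in> carrier R" using m_carrier[OF a(1)] .
    have "proj a [^]\<^bsub>?A\<^esub> (Suc r) \<in> proj ` Q"
      unfolding proj_nat_pow[OF ac] using mem[OF nat_pow_closed[OF ac]] pow'[OF a(1)] by blast
    then show "x \<in> radical ?A (proj ` Q)" unfolding radical_def carrier_quot using a ac by blast
  qed
  have "P \<noteq> carrier R" using Pm m.I_notcarr m.a_subset by blast
  then have "proj ` Q \<noteq> carrier ?A" using proj_eq_carrier_iff[OF Q(1)] by (simp add: P_def)
  moreover have "y \<in> radical ?A (proj ` Q)"
    if xy: "x \<in> carrier ?A" "y \<in> carrier ?A" "x \<otimes>\<^bsub>?A\<^esub> y \<in> proj ` Q" "x \<notin> proj ` Q" for x y
  proof -
    obtain a b where ab: "a \<in> carrier R" "b \<in> carrier R" "x = proj a" "y = proj b"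
      using xy(1,2) unfolding carrier_quot by blast
    have "x \<otimes>\<^bsub>?A\<^esub> y = proj (a \<otimes> b)" unfolding ab(3,4)
      using ring_hom_mult[OF ideal.rcos_ring_hom[OF I] ab(1,2)] by simp
    then have "a \<otimes> b \<in> P" "a \<notin> P" using xy(3,4) mem[of "a \<otimes> b"] mem[of a] ab by auto
    then have "b \<in> m" using unit_mult_cancel_ideal[OF iP ab(2) _ ab(1)] m_comm[OF ab(1,2)] by auto
    then show ?thesis unfolding rad ab(4) by blast
  qed
  ultimately show ?thesis unfolding primary_to_def using proj_ideal[OF Q(1)] rad by blast
qed

lemma is_reduction_iff:
  assumes "ideal Q R" "Q \<subseteq> m"
  shows "is_reduction (R Quot I) (proj ` m) (proj ` Q) \<longleftrightarrow> (\<exists>r. red_at I Q r)"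
  unfolding is_reduction_def reduction_eq_iff_red_at[OF assms]
  using primary_quot[OF assms] assms(2) by blast

lemma is_reductionE:
  assumes "is_reduction (R Quot I) (proj ` m) q"
  obtains Q r where "ideal Q R" "Q \<subseteq> m" "q = proj ` Q" "red_at I Q r"
proof -
  have q: "ideal q (R Quot I)" "q \<subseteq> proj ` m"
    using assms by (auto simp: is_reduction_def primary_to_def)
  obtain Q where Q: "ideal Q R" "q = proj ` Q" "I \<subseteq> Q" using quot_idealE[OF q(1)] .
  have "Q \<subseteq> m"
    using q(2) proj_image_subset_iff[OF Q(1) m_ideal] set_add_I_absorb[OF m_ideal I_subset_m] Q(2) by simp
  moreover then obtain r where "red_at I Q r" using is_reduction_iff[OF Q(1)] assms Q(2) by blast
  ultimately show thesis using that Q by blast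
qed

lemma minimal_reduction_proj:
  assumes X: "finite X" "X \<subseteq> m" "card X \<le> analytic_spread I" "red_at I (Idl X) r"
  shows "minimal_reduction (R Quot I) (proj ` m) (proj ` (Idl X))"
proof -
  have iX: "ideal (Idl X) R" using X(2) m_carrier by (intro ideal_Idl) blast
  have "is_reduction (R Quot I) (proj ` m) (proj ` (Idl X))"
    using is_reduction_iff[OF iX Idl_subset_m[OF X(2)]] X(4) by blast
  moreover have "q = proj ` (Idl X)"
    if q: "is_reduction (R Quot I) (proj ` m) q" "q \<subseteq> proj ` (Idl X)" for q
  proof -
    obtain Q s where Q: "ideal Q R" "Q \<subseteq> m" "q = proj ` Q" "red_at I Q s" using is_reductionE[OF q(1)] .
    have "Q \<subseteq> Idl X <+> I" using q(2) unfolding Q(3) proj_image_subset_iff[OF Q(1) iX] .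
    from small_reduction_minimal[OF I I_subset_m X(1-3) Q(1) this Q(4)]
    have "proj ` (Idl X) \<subseteq> q" unfolding Q(3) proj_image_subset_iff[OF iX Q(1)] .
    with q(2) show ?thesis by blast
  qed
  ultimately show ?thesis unfolding minimal_reduction_def by blast
qed

lemma red_num_wrt_proj:
  assumes "ideal Q R" "Q \<subseteq> m"
  shows "red_num_wrt (R Quot I) (proj ` m) (proj ` Q) = (LEAST r. red_at I Q r)"
  unfolding red_num_wrt_def reduction_eq_iff_red_at[OF assms] ..

lemma red_num_le:
  assumes X: "finite X" "X \<subseteq> m" "card X \<le> analytic_spread I" "red_at I (Idl X) r"
  shows "red_num (R Quot I) \<le> r"
proof -
  have iX: "ideal (Idl X) R" using X(2) m_carrier by (intro ideal_Idl) blast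
  have "red_num (R Quot I) \<le> red_num_wrt (R Quot I) (proj ` m) (proj ` (Idl X))"
    unfolding red_num_def max_ideal_quot
    by (rule cInf_lower) (use minimal_reduction_proj[OF X] in auto)
  also have "\<dots> \<le> r"
    unfolding red_num_wrt_proj[OF iX Idl_subset_m[OF X(2)]] using X(4) by (rule Least_le)
  finally show ?thesis .
qed

text \<open>An optimal minimal reduction is known only as an ideal of the quotient. It contains the
  image of a reduction with at most \<open>analytic_spread I\<close> generators; minimality makes
  both images equal, so these generators in \<open>R\<close> carry the optimal exponent.\<close>

lemma red_num_attained:
  obtains X where "finite X" "X \<subseteq> m" "card X = analytic_spread I" "red_at I (Idl X) (red_num (R Quot I))"
proof -
  obtain X0 r0 where X0: "finite X0" "X0 \<subseteq> m" "card X0 = analytic_spread I" "red_at I (Idl X0) r0"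
    using analytic_spread_attained[OF I] .
  let ?S = "{red_num_wrt (R Quot I) (proj ` m) q | q. minimal_reduction (R Quot I) (proj ` m) q}"
  \<comment> \<open>\<open>Inf\<close> on \<open>nat\<close> is known to be attained once the set is
    nonempty, so the existence of minimal reductions enters here.\<close>
  have "?S \<noteq> {}" using minimal_reduction_proj[OF X0(1,2) _ X0(4)] X0(3) by auto
  then have "red_num (R Quot I) \<in> ?S" unfolding red_num_def max_ideal_quot by (rule Inf_nat_def1)
  then obtain q where q: "minimal_reduction (R Quot I) (proj ` m) q"
    "red_num (R Quot I) = red_num_wrt (R Quot I) (proj ` m) q" by blast
  obtain Q s where Q: "ideal Q R" "Q \<subseteq> m" "q = proj ` Q" "red_at I Q s"
    using is_reductionE q(1) unfolding minimal_reduction_def by blast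
  obtain X r where X: "finite X" "X \<subseteq> Q" "card X \<le> card X0" "red_at I (Idl X) r"
    using reduction_contains_small_reduction[OF I Q(1,2,4) X0(1,2,4)] by blast
  have Xm: "X \<subseteq> m" using X(2) Q(2) by blast
  have iX: "ideal (Idl X) R" using Xm m_carrier by (intro ideal_Idl) blast
  have "is_reduction (R Quot I) (proj ` m) (proj ` (Idl X))"
    using is_reduction_iff[OF iX Idl_subset_m[OF Xm]] X(4) by blast
  moreover have "proj ` (Idl X) \<subseteq> q" unfolding Q(3) using genideal_minimal[OF Q(1) X(2)] by blast
  ultimately have "proj ` (Idl X) = q" using q(1) unfolding minimal_reduction_def by blast
  then have "red_num (R Quot I) = (LEAST r. red_at I (Idl X) r)"
    using q(2) red_num_wrt_proj[OF iX Idl_subset_m[OF Xm]] by simp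
  then have "red_at I (Idl X) (red_num (R Quot I))" using LeastI[of "red_at I (Idl X)", OF X(4)] by simp
  moreover have "card X = analytic_spread I" using analytic_spread_le[OF X(1) Xm X(4)] X(3) X0(3) by simp
  ultimately show thesis using that X(1) Xm by blast
qed

end

end

section \<open>Reduction numbers along a filtration\<close>

lemma subadditive_le_multiple:
  fixes f :: "nat \<Rightarrow> real"
  assumes "\<And>a b. a \<ge> 1 \<Longrightarrow> b \<ge> 1 \<Longrightarrow> f (a + b) \<le> f a + f b" "n \<ge> 1"
  shows "f n \<le> n * f 1"
  using assms(2)
proof (induct n rule: dec_induct)
  case (step n)
  then show ?case using assms(1)[of n 1] by (simp add: algebra_simps)
qed simp

lemma fekete:
  fixes f :: "nat \<Rightarrow> real"
  assumes sub: "\<And>a b. a \<ge> 1 \<Longrightarrow> b \<ge> 1 \<Longrightarrow> f (a + b) \<le> f a + f b"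
    and nonneg: "\<And>n. 0 \<le> f n"
  shows "\<exists>c. (\<lambda>n. f n / n) \<longlonglongrightarrow> c \<and> (\<forall>n\<ge>1. c * n \<le> f n)"
proof -
  define c where "c = (INF n\<in>{1..}. f n / real n)"
  have bdd: "bdd_below ((\<lambda>n. f n / real n) ` {1..})"
    by (rule bdd_belowI[of _ 0]) (auto simp: nonneg)
  have lower: "c \<le> f n / n" if "n \<ge> 1" for n
    unfolding c_def using that by (intro cINF_lower[OF bdd]) auto
  have "(\<lambda>n. f n / n) \<longlonglongrightarrow> c"
  proof (rule LIMSEQ_I)
    fix e :: real assume e: "0 < e"
    have "\<exists>k\<in>{1..}. f k / real k < c + e / 2"
      using cINF_less_iff[OF _ bdd, of "c + e / 2"] e by (auto simp: c_def)
    then obtain k where k: "k \<ge> 1" "f k / k < c + e / 2" by auto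
    define M where "M = Max (f ` {1..k})"
    have M: "f n \<le> M" if "1 \<le> n" "n \<le> k" for n unfolding M_def using that by (intro Max_ge) auto
    \<comment> \<open>Repeated subtraction of \<open>k\<close> stands for division with remainder.
      Remainders run over \<open>{1..k}\<close> because subadditivity is assumed only from
      \<open>1\<close> on.\<close>
    have bound: "f n \<le> real n * (f k / k) + M" if "n \<ge> 1" for n
      using that
    proof (induct n rule: less_induct)
      case (less n)
      show ?case
      proof (cases "n \<le> k")
        case True
        have "0 \<le> real n * (f k / k)" using nonneg by simp
        then show ?thesis using M[OF less.prems True] by linarith
      next
        case False
        then have "f n \<le> f (n - k) + f k" using sub[of "n - k" k] k(1) by simp
        moreover have "f (n - k) \<le> real (n - k) * (f k / k) + M" using less.hyps[of "n - k"] False k(1) by simp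
        moreover have "real (n - k) * (f k / k) + f k = real n * (f k / k)"
          using False k(1) by (simp add: of_nat_diff field_simps)
        ultimately show ?thesis by linarith
      qed
    qed
    obtain N :: nat where N: "2 * \<bar>M\<bar> / e < N" using reals_Archimedean2 by blast
    have "norm (f n / n - c) < e" if "n \<ge> max 1 N" for n
    proof -
      have n: "real n > 0" "real N \<le> real n" using that by auto
      have "2 * \<bar>M\<bar> < e * N" using N e by (simp add: field_simps)
      also have "\<dots> \<le> e * n" using n(2) e by (intro mult_left_mono) auto
      finally have "2 * \<bar>M\<bar> < e * n" .
      then have "M / n < e / 2" using n(1) by (simp add: field_simps)
      moreover have "f n / n \<le> f k / k + M / n"
        using bound[of n] that n(1) by (simp add: field_simps)
      ultimately have "f n / n < c + e" using k(2) by linarith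
      then show ?thesis using lower[of n] that by simp
    qed
    then show "\<exists>no. \<forall>n\<ge>no. norm (f n / real n - c) < e" by blast
  qed
  moreover have "c * n \<le> f n" if "n \<ge> 1" for n
    using lower[OF that] that by (simp add: field_simps)
  ultimately show ?thesis by blast
qed

section \<open>The quotients by one filtration\<close>

context noetherian_local_ring_inf
begin

context
  fixes F :: "nat \<Rightarrow> 'a set"
  assumes F_ideal: "\<And>n. n \<ge> 1 \<Longrightarrow> ideal (F n) R"
    and F_proper: "\<And>n. n \<ge> 1 \<Longrightarrow> F n \<noteq> carrier R"
    and F_decr: "\<And>n. n \<ge> 1 \<Longrightarrow> F (Suc n) \<subseteq> F n"
    and F_mult: "\<And>a b. a \<ge> 1 \<Longrightarrow> b \<ge> 1 \<Longrightarrow> F a \<cdot> F b \<subseteq> F (a + b)"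
begin

lemma filtration_subset_first: "n \<ge> 1 \<Longrightarrow> F n \<subseteq> F 1"
  by (induct n rule: dec_induct) (use F_decr in auto)

text \<open>Upward, \<open>F n \<cdot> F 1 \<subseteq> F (Suc n)\<close> lets
  \<open>red_at_mult\<close> climb one level at the price of a larger exponent.\<close>

lemma reduction_mod_filtration_iff:
  assumes Q: "ideal Q R" "Q \<subseteq> m" and "n \<ge> 1"
  shows "(\<exists>r. red_at (F n) Q r) \<longleftrightarrow> (\<exists>r. red_at (F 1) Q r)"
proof
  assume "\<exists>r. red_at (F n) Q r"
  then show "\<exists>r. red_at (F 1) Q r"
    using red_at_mono[OF F_ideal[OF assms(3)] F_ideal[of 1] Q(1) Q(1)] filtration_subset_first[OF assms(3)] by auto
next
  assume 1: "\<exists>r. red_at (F 1) Q r"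
  show "\<exists>r. red_at (F n) Q r"
    using assms(3)
  proof (induct n rule: dec_induct)
    case (step n)
    then show ?case
      using red_at_mult[OF F_ideal[of n] F_ideal[of 1] F_ideal[of "Suc n"] _ Q] F_mult[of n 1] 1 by auto
  qed (use 1 in auto)
qed

lemma analytic_spread_filtration:
  assumes "n \<ge> 1"
  shows "analytic_spread (F n) = analytic_spread (F 1)"
proof -
  have "(\<exists>r. red_at (F n) (Idl X) r) \<longleftrightarrow> (\<exists>r. red_at (F 1) (Idl X) r)" if "X \<subseteq> m" for X
    by (rule reduction_mod_filtration_iff[OF ideal_Idl Idl_subset_m[OF that] assms])
      (use that m_carrier in blast)
  then have "(\<exists>X r. finite X \<and> X \<subseteq> m \<and> card X = k \<and> red_at (F n) (Idl X) r) \<longleftrightarrow>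
    (\<exists>X r. finite X \<and> X \<subseteq> m \<and> card X = k \<and> red_at (F 1) (Idl X) r)" for k
    by blast
  then show ?thesis unfolding analytic_spread_def by presburger
qed

lemma red_num_subadditive:
  assumes "a \<ge> 1" "b \<ge> 1"
  shows "red_num (R Quot F (a + b)) + 1 \<le> (red_num (R Quot F a) + 1) + (red_num (R Quot F b) + 1)"
proof -
  let ?s = "analytic_spread (F 1)"
  have ab: "a + b \<ge> 1" using assms by simp
  obtain X where X: "finite X" "X \<subseteq> m" "card X = ?s" "red_at (F a) (Idl X) (red_num (R Quot F a))"
    using red_num_attained[OF F_ideal F_proper] analytic_spread_filtration assms(1) by metis
  obtain Y where Y: "finite Y" "Y \<subseteq> m" "card Y = ?s" "red_at (F b) (Idl Y) (red_num (R Quot F b))"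
    using red_num_attained[OF F_ideal F_proper] analytic_spread_filtration assms(2) by metis
  obtain Z where Z: "finite Z" "Z \<subseteq> m" "card Z \<le> ?s"
    "red_at (F a) (Idl Z) (red_num (R Quot F a))" "red_at (F b) (Idl Z) (red_num (R Quot F b))"
    using common_reduction[OF F_ideal F_ideal X(1,2,4) Y(1,2,4)] assms X(3) Y(3) by metis
  have iZ: "ideal (Idl Z) R" using Z(2) m_carrier by (intro ideal_Idl) blast
  have "red_at (F (a + b)) (Idl Z) (red_num (R Quot F a) + red_num (R Quot F b) + 1)"
    by (rule red_at_mult[OF F_ideal F_ideal F_ideal F_mult iZ Idl_subset_m Z(4,5)]) (use assms Z in auto)
  \<comment> \<open>Minimality modulo \<open>F (a + b)\<close> comes from this count, as the spread
    is the same on all levels.\<close>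
  moreover have "card Z \<le> analytic_spread (F (a + b))" using Z(3) analytic_spread_filtration[OF ab] by simp
  ultimately have "red_num (R Quot F (a + b)) \<le> red_num (R Quot F a) + red_num (R Quot F b) + 1"
    using red_num_le[OF F_ideal F_proper] ab Z(1,2) by metis
  then show ?thesis by simp
qed

end

end

theorem theorem1p5:
  fixes R :: "('a, 'b) ring_scheme" and m :: "'a set" and I :: "nat \<Rightarrow> 'a set"
  assumes local: "noeth_local R m"
    and inf_res: "infinite (carrier (R Quot m))"
    and ideals: "\<And>n. n \<ge> 1 \<Longrightarrow> ideal (I n) R \<and> I n \<noteq> carrier R"
    and decr: "\<And>n. n \<ge> 1 \<Longrightarrow> I (Suc n) \<subseteq> I n"
    and mult: "\<And>a b. a \<ge> 1 \<Longrightarrow> b \<ge> 1 \<Longrightarrow> ideal_prod R (I a) (I b) \<subseteq> I (a + b)"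
    and dims: "\<And>n. n \<ge> 1 \<Longrightarrow> krull_dim (R Quot (I n)) = krull_dim (R Quot (I 1))"
  shows "(\<forall>n\<ge>1. int (red_num (R Quot (I n))) \<le> (int (red_num (R Quot (I 1))) + 1) * int n - 1)
       \<and> (\<exists>c::real. ((\<lambda>n. real (red_num (R Quot (I n))) / real n) \<longlonglongrightarrow> c)
              \<and> (\<forall>n\<ge>1. real (red_num (R Quot (I n))) \<ge> c * real n - 1))"
proof -
  interpret noetherian_local_ring_inf R m
    using local inf_res
    by (auto simp: noeth_local_def noetherian_local_ring_inf_def noetherian_local_ring_def
        noetherian_local_ring_axioms_def noetherian_local_ring_inf_axioms_def)
  \<comment> \<open>The shift gives subadditivity and is the source of both constants
    \<open>-1\<close>: \<open>f n \<le> n * f 1\<close> is the upper bound and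
    \<open>c * n \<le> f n\<close> the lower one.\<close>
  define f where "f n = real (red_num (R Quot I n)) + 1" for n
  have sub: "f (a + b) \<le> f a + f b" if "a \<ge> 1" "b \<ge> 1" for a b
    using red_num_subadditive[of I a b] ideals decr mult that by (simp add: f_def)
  have "int (red_num (R Quot (I n))) \<le> (int (red_num (R Quot (I 1))) + 1) * int n - 1" if "n \<ge> 1" for n
  proof -
    have "f n \<le> n * f 1" by (rule subadditive_le_multiple[OF sub that])
    then have "real_of_int (int (red_num (R Quot (I n)))) \<le> real_of_int ((int (red_num (R Quot (I 1))) + 1) * int n - 1)"
      by (simp add: f_def algebra_simps)
    then show ?thesis by (simp only: of_int_le_iff)
  qed
  moreover obtain c where c: "(\<lambda>n. f n / n) \<longlonglongrightarrow> c" "\<And>n. n \<ge> 1 \<Longrightarrow> c * n \<le> f n"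
    using fekete[of f, OF sub] by (auto simp: f_def)
  have "(\<lambda>n. f n / n - 1 / n) \<longlonglongrightarrow> c - 0"
    by (intro tendsto_diff c(1) lim_1_over_n)
  then have "(\<lambda>n. real (red_num (R Quot (I n))) / real n) \<longlonglongrightarrow> c"
    by (simp add: f_def add_divide_distrib)
  moreover have "real (red_num (R Quot (I n))) \<ge> c * real n - 1" if "n \<ge> 1" for n
    using c(2)[OF that] by (simp add: f_def)
  ultimately show ?thesis by blast
qed

end
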